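(* Let $G$ be a non-discrete LCA group with dual $\Gamma$, $V$ an open neighbourhood of $0\in\Gamma$ with compact closure $\bar V$, $\mu$ a positive unbounded Radon measure on $\Gamma$ and $1\le p<\infty$. Then $\mathcal A_{p,\mu}(\Gamma):=\{\psi\in\mathcal A(\Gamma):\psi\in L^p(\mu)\}$ with the norm $\|\psi\|_{\mathcal A_{p,\mu}}:=\|\psi\|^{\bar V}+\|\psi\|_{L^p(\mu)}$ is a Segal algebra in $\mathcal A(\Gamma)$.
   Context: $G$ non-discrete LCA with dual $\Gamma$, $(x,\gamma)=\gamma(x)$. For $E\subseteq\Gamma$, $\mathrm{span}(E)$ is the span of the characters in $E$ as functions on $G$, each $p=\sum\hat p(\gamma)\gamma$ uniquely, $\|p\|_\infty=\sup_G|p|$. For $\phi\in C_b(\Gamma)$: $\|\phi\|^{\bar V,\gamma}=\sup\{|\sum_{\gamma'\in\bar V+\gamma}\hat p(\gamma')\phi(\gamma')|:p\in\mathrm{span}(\bar V+\gamma),\|p\|_\infty\le1\}$, $\|\phi\|^{\bar V}=\sup_\gamma\|\phi\|^{\bar V,\gamma}$, $C^{\bar V}_{BSE}(\Gamma)=\{\phi\in C_b(\Gamma):\|\phi\|^{\bar V}<\infty\}$. With $\mathcal K(\Gamma)$ the compact subsets of $\Gamma$ with dense nonempty interior directed by inclusion, $\mathcal A(\Gamma)=\{\psi\in C^{\bar V}_{BSE}(\Gamma):\lim_{\Omega\in\mathcal K(\Gamma)}\sup_{\gamma\notin\Omega}\|\psi\|^{\bar V,\gamma}=0\}$, a commutative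 Banach function algebra under $\|\cdot\|^{\bar V}$. A Segal algebra in $\mathcal A(\Gamma)$ is a dense ideal $\mathcal S$ that is a Banach space under a norm $\|\cdot\|_{\mathcal S}\ge\|\cdot\|^{\bar V}$, with $\|\phi\psi\|_{\mathcal S}\le\|\phi\|_{\mathcal S}\|\psi\|^{\bar V}$ ($\phi\in\mathcal S,\psi\in\mathcal A(\Gamma)$), and having approximate units (for each $\phi\in\mathcal S$, $\varepsilon>0$ some $u\in\mathcal S$ has $\|\phi-u\phi\|_{\mathcal S}<\varepsilon$). *)

theory Defs
  imports "HOL-Analysis.Analysis"
begin

definition topological_ab_group :: "('a::{ab_group_add, topological_space}) itself \<Rightarrow> bool" where
  "topological_ab_group _ \<longleftrightarrow>
     continuous_on UNIV (\<lambda>p::'a \<times> 'a. fst p + snd p) \<and> continuous_on UNIV (\<lambda>x::'a. - x)"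

definition locally_compact_type :: "('a::topological_space) itself \<Rightarrow> bool" where
  "locally_compact_type _ \<longleftrightarrow>
     (\<forall>x::'a. \<exists>U K. open U \<and> compact K \<and> x \<in> U \<and> U \<subseteq> K)"

definition LCA :: "('a::{ab_group_add, t2_space}) itself \<Rightarrow> bool" where
  "LCA T \<longleftrightarrow> topological_ab_group T \<and> locally_compact_type T"

definition cont_character :: "('a::{ab_group_add, topological_space} \<Rightarrow> complex) \<Rightarrow> bool" where
  "cont_character chr \<longleftrightarrow> continuous_on UNIV chr \<and> (\<forall>x. cmod (chr x) = 1) \<and>
     (\<forall>x y. chr (x + y) = chr x * chr y)"

text \<open>\<open>pair x \<gamma> = (x,\<gamma>) = \<gamma>(x)\<close> exhibits the topological group \<open>'g\<close> as the dual group of \<open>'a\<close>: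
  \<open>\<gamma> \<mapsto> pair _ \<gamma>\<close> is a group isomorphism of \<open>'g\<close> onto the group of continuous
  characters of \<open>'a\<close> (pointwise multiplication), and the topology of \<open>'g\<close> is the compact-open
  topology (uniform convergence on compact subsets of \<open>'a\<close>).\<close>
definition is_dual_pairing ::
  "('a::{ab_group_add, topological_space} \<Rightarrow> 'g::{ab_group_add, topological_space} \<Rightarrow> complex) \<Rightarrow> bool" where
  "is_dual_pairing pair \<longleftrightarrow>
     (\<forall>\<gamma>. cont_character (\<lambda>x. pair x \<gamma>)) \<and>
     (\<forall>x \<gamma> \<delta>. pair x (\<gamma> + \<delta>) = pair x \<gamma> * pair x \<delta>) \<and>
     bij_betw (\<lambda>\<gamma> x. pair x \<gamma>) UNIV {chr. cont_character chr} \<and>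
     (\<forall>U::'g set. open U \<longleftrightarrow>
        (\<forall>\<gamma>0\<in>U. \<exists>K::'a set. \<exists>\<epsilon>>0. compact K \<and>
            {\<gamma>. \<forall>x\<in>K. cmod (pair x \<gamma> - pair x \<gamma>0) < \<epsilon>} \<subseteq> U))"

text \<open>Finitely supported coefficient families with support in \<open>E\<close>; each represents the
  trigonometric polynomial \<open>p = \<Sum> \<hat>p(\<gamma>) \<gamma>\<close> in \<open>span(E)\<close> (the representation is unique).\<close>
definition coeffs_in :: "'g set \<Rightarrow> ('g \<Rightarrow> complex) set" where
  "coeffs_in E = {c. finite {\<gamma>. c \<gamma> \<noteq> 0} \<and> {\<gamma>. c \<gamma> \<noteq> 0} \<subseteq> E}"

definition trig_poly :: "('a \<Rightarrow> 'g \<Rightarrow> complex) \<Rightarrow> ('g \<Rightarrow> complex) \<Rightarrow> 'a \<Rightarrow> complex" where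
  "trig_poly pair c x = (\<Sum>\<gamma>\<in>{\<gamma>. c \<gamma> \<noteq> 0}. c \<gamma> * pair x \<gamma>)"

definition loc_norm :: "('a \<Rightarrow> 'g::ab_group_add \<Rightarrow> complex) \<Rightarrow> 'g set \<Rightarrow> ('g \<Rightarrow> complex) \<Rightarrow> 'g \<Rightarrow> ereal" where
  "loc_norm pair W \<phi> \<gamma> =
     (SUP c \<in> {c \<in> coeffs_in ((\<lambda>v. v + \<gamma>) ` W). \<forall>x. cmod (trig_poly pair c x) \<le> 1}.
        ereal (cmod (\<Sum>\<gamma>'\<in>{\<gamma>'. c \<gamma>' \<noteq> 0}. c \<gamma>' * \<phi> \<gamma>')))"

definition bse_norm :: "('a \<Rightarrow> 'g::ab_group_add \<Rightarrow> complex) \<Rightarrow> 'g set \<Rightarrow> ('g \<Rightarrow> complex) \<Rightarrow> ereal" where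
  "bse_norm pair W \<phi> = (SUP \<gamma>. loc_norm pair W \<phi> \<gamma>)"

definition Cb :: "('g::topological_space \<Rightarrow> complex) set" where
  "Cb = {\<phi>. continuous_on UNIV \<phi> \<and> bounded (range \<phi>)}"

definition C_BSE :: "('a \<Rightarrow> 'g::{ab_group_add,topological_space} \<Rightarrow> complex) \<Rightarrow> 'g set \<Rightarrow> ('g \<Rightarrow> complex) set" where
  "C_BSE pair W = {\<phi> \<in> Cb. bse_norm pair W \<phi> < \<infinity>}"

definition KK :: "('g::topological_space) set set" where
  "KK = {\<Omega>. compact \<Omega> \<and> interior \<Omega> \<noteq> {} \<and> \<Omega> \<subseteq> closure (interior \<Omega>)}"

text \<open>The algebra \<open>\<A>(\<Gamma>)\<close>: the limit along the directed set \<open>KK\<close> (ordered by inclusion) is 0.\<close>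
definition AA :: "('a \<Rightarrow> 'g::{ab_group_add,topological_space} \<Rightarrow> complex) \<Rightarrow> 'g set \<Rightarrow> ('g \<Rightarrow> complex) set" where
  "AA pair W = {\<psi> \<in> C_BSE pair W.
     \<forall>\<epsilon>>0. \<exists>\<Omega>0\<in>KK. \<forall>\<Omega>\<in>KK. \<Omega>0 \<subseteq> \<Omega> \<longrightarrow>
        (SUP \<gamma>\<in>-\<Omega>. loc_norm pair W \<psi> \<gamma>) < ereal \<epsilon>}"

definition AA_norm :: "('a \<Rightarrow> 'g::ab_group_add \<Rightarrow> complex) \<Rightarrow> 'g set \<Rightarrow> ('g \<Rightarrow> complex) \<Rightarrow> real" where
  "AA_norm pair W \<psi> = real_of_ereal (bse_norm pair W \<psi>)"

definition segal_algebra ::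
  "('g \<Rightarrow> complex) set \<Rightarrow> (('g \<Rightarrow> complex) \<Rightarrow> real) \<Rightarrow> ('g \<Rightarrow> complex) set \<Rightarrow> (('g \<Rightarrow> complex) \<Rightarrow> real) \<Rightarrow> bool" where
  "segal_algebra A nA S nS \<longleftrightarrow>
     \<comment> \<open>dense ideal\<close>
     S \<subseteq> A \<and>
     (\<forall>\<phi>\<in>S. \<forall>\<psi>\<in>A. (\<lambda>\<gamma>. \<phi> \<gamma> * \<psi> \<gamma>) \<in> S) \<and>
     (\<forall>\<psi>\<in>A. \<forall>\<epsilon>>0. \<exists>\<phi>\<in>S. nA (\<lambda>\<gamma>. \<psi> \<gamma> - \<phi> \<gamma>) < \<epsilon>) \<and>
     \<comment> \<open>Banach space under \<open>nS\<close>\<close>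
     (\<lambda>_. 0) \<in> S \<and>
     (\<forall>\<phi>\<in>S. \<forall>\<psi>\<in>S. (\<lambda>\<gamma>. \<phi> \<gamma> + \<psi> \<gamma>) \<in> S) \<and>
     (\<forall>a::complex. \<forall>\<phi>\<in>S. (\<lambda>\<gamma>. a * \<phi> \<gamma>) \<in> S) \<and>
     (\<forall>\<phi>\<in>S. nS \<phi> = 0 \<longleftrightarrow> \<phi> = (\<lambda>_. 0)) \<and>
     (\<forall>\<phi>\<in>S. \<forall>\<psi>\<in>S. nS (\<lambda>\<gamma>. \<phi> \<gamma> + \<psi> \<gamma>) \<le> nS \<phi> + nS \<psi>) \<and>
     (\<forall>a::complex. \<forall>\<phi>\<in>S. nS (\<lambda>\<gamma>. a * \<phi> \<gamma>) = cmod a * nS \<phi>) \<and>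
     (\<forall>f::nat \<Rightarrow> 'g \<Rightarrow> complex. (\<forall>n. f n \<in> S) \<longrightarrow>
        (\<forall>\<epsilon>>0. \<exists>N. \<forall>m\<ge>N. \<forall>n\<ge>N. nS (\<lambda>\<gamma>. f m \<gamma> - f n \<gamma>) < \<epsilon>) \<longrightarrow>
        (\<exists>\<phi>\<in>S. (\<lambda>n. nS (\<lambda>\<gamma>. f n \<gamma> - \<phi> \<gamma>)) \<longlonglongrightarrow> 0)) \<and>
     \<comment> \<open>norm comparison and module inequality\<close>
     (\<forall>\<phi>\<in>S. nA \<phi> \<le> nS \<phi>) \<and>
     (\<forall>\<phi>\<in>S. \<forall>\<psi>\<in>A. nS (\<lambda>\<gamma>. \<phi> \<gamma> * \<psi> \<gamma>) \<le> nS \<phi> * nA \<psi>) \<and>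
     \<comment> \<open>approximate units\<close>
     (\<forall>\<phi>\<in>S. \<forall>\<epsilon>>0. \<exists>u\<in>S. nS (\<lambda>\<gamma>. \<phi> \<gamma> - u \<gamma> * \<phi> \<gamma>) < \<epsilon>)"

definition radon_measure :: "('g::topological_space) measure \<Rightarrow> bool" where
  "radon_measure \<mu> \<longleftrightarrow> sets \<mu> = sets borel \<and>
     (\<forall>K. compact K \<longrightarrow> emeasure \<mu> K < \<infinity>) \<and>
     (\<forall>A\<in>sets borel. emeasure \<mu> A = (INF U \<in> {U. open U \<and> A \<subseteq> U}. emeasure \<mu> U)) \<and>
     (\<forall>U. open U \<longrightarrow> emeasure \<mu> U = (SUP K \<in> {K. compact K \<and> K \<subseteq> U}. emeasure \<mu> K))"

definition in_Lp :: "real \<Rightarrow> 'g measure \<Rightarrow> ('g \<Rightarrow> complex) \<Rightarrow> bool" where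
  "in_Lp p \<mu> \<psi> \<longleftrightarrow> \<psi> \<in> borel_measurable \<mu> \<and>
     (\<integral>\<^sup>+ \<gamma>. ennreal (cmod (\<psi> \<gamma>) powr p) \<partial>\<mu>) < \<infinity>"

definition Lp_norm :: "real \<Rightarrow> 'g measure \<Rightarrow> ('g \<Rightarrow> complex) \<Rightarrow> real" where
  "Lp_norm p \<mu> \<psi> = (enn2real (\<integral>\<^sup>+ \<gamma>. ennreal (cmod (\<psi> \<gamma>) powr p) \<partial>\<mu>)) powr (1 / p)"

end

theory Submission
  imports Defs
begin

text \<open>Everything rests on compactly supported functions with uniformly bounded local norms that are \<open>1\<close> on a
  prescribed compact set. The local norm at \<open>\<gamma>\<close> only sees \<open>W + \<gamma>\<close> (with \<open>W = closure V\<close>), is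
  submultiplicative, closed under pointwise limits, and at most \<open>1\<close> on the functions \<open>(x,\<cdot>)\<close>; so no Haar
  measure or inversion theorem is needed. If \<open>r\<close> is real with norm at most \<open>1\<close>, then
  \<open>1 - \<surd>(1 - r\<^sup>2)\<close> is a limit of polynomials in \<open>r\<close> of norm at most \<open>1\<close>. For
  \<open>r = Re (w (x,\<cdot>))\<close> with \<open>|w| = 1\<close> this bounds the norms of \<open>|Im (w (x,\<cdot>))|\<close> and \<open>max 0 (Im (w (x,\<cdot>)))\<close>.
  With \<open>w = c + i s\<close>, the product of \<open>max 0 (Im (w (x,\<cdot>)))\<close> and \<open>max 0 (Im (w (-x,\<cdot>)))\<close> is
  \<open>(Re (x,\<cdot>))\<^sup>2 - c\<^sup>2\<close> on the arc \<open>Re (x,\<cdot>) \<ge> c\<close> and \<open>0\<close> elsewhere, so differences of two of these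
  are constant near \<open>0\<close> and vanish off an arc. Finite products of such bumps separate \<open>0\<close> from compact sets.
  Multiplying by the resulting local units gives both the density and the approximate units;
  completeness follows from uniform convergence and Fatou's lemma.\<close>

section \<open>The dual group\<close>

locale dual_pairing =
  fixes pair :: "'a::{ab_group_add, topological_space} \<Rightarrow> 'g::{ab_group_add, topological_space} \<Rightarrow> complex"
  assumes dual: "is_dual_pairing pair"
begin

section \<open>Algebra of the pairing and separation of points\<close>

lemma character: "cont_character (\<lambda>x. pair x \<gamma>)"
  using dual by (simp add: is_dual_pairing_def)

lemma continuous_pair_left: "continuous_on S (\<lambda>x. pair x \<gamma>)"
  using character[of \<gamma>] by (auto simp: cont_character_def intro: continuous_on_subset)

lemma cmod_pair [simp]: "cmod (pair x \<gamma>) = 1"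
  using character[of \<gamma>] by (simp add: cont_character_def)

lemma pair_nonzero [simp]: "pair x \<gamma> \<noteq> 0"
  by (metis cmod_pair norm_zero zero_neq_one)

lemma pair_add_left: "pair (x + y) \<gamma> = pair x \<gamma> * pair y \<gamma>"
  using character[of \<gamma>] by (simp add: cont_character_def)

lemma pair_add_right: "pair x (\<gamma> + \<delta>) = pair x \<gamma> * pair x \<delta>"
  using dual by (simp add: is_dual_pairing_def)

lemma pair_zero_left [simp]: "pair 0 \<gamma> = 1"
  using pair_add_left[of 0 0 \<gamma>] by simp

lemma pair_zero_right [simp]: "pair x 0 = 1"
  using pair_add_right[of x 0 0] by simp

lemma pair_minus_right: "pair x (- \<gamma>) = cnj (pair x \<gamma>)"
proof -
  have "pair x \<gamma> * pair x (- \<gamma>) = 1"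
    using pair_add_right[of x \<gamma> "- \<gamma>"] by simp
  moreover have "pair x \<gamma> * cnj (pair x \<gamma>) = 1"
    by (simp add: complex_mult_cnj flip: cmod_power2)
  ultimately show ?thesis
    by (metis mult_cancel_left pair_nonzero)
qed

lemma pair_minus_left: "pair (- x) \<gamma> = cnj (pair x \<gamma>)"
proof -
  have "pair x \<gamma> * pair (- x) \<gamma> = 1"
    using pair_add_left[of x "- x" \<gamma>] by simp
  moreover have "pair x \<gamma> * cnj (pair x \<gamma>) = 1"
    by (simp add: complex_mult_cnj flip: cmod_power2)
  ultimately show ?thesis
    by (metis mult_cancel_left pair_nonzero)
qed

lemma pair_separates:
  assumes "\<gamma> \<noteq> \<delta>"
  obtains x where "pair x \<gamma> \<noteq> pair x \<delta>"
proof -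
  have "inj (\<lambda>\<gamma> x. pair x \<gamma>)"
    using dual by (auto simp: is_dual_pairing_def bij_betw_def)
  then show thesis
    using assms that by (metis injD ext)
qed

section \<open>The compact-open topology: Hausdorff property and continuity of the group
  operations\<close>

lemma open_dual_iff:
  "open U \<longleftrightarrow> (\<forall>\<gamma>0\<in>U. \<exists>K. \<exists>\<epsilon>>0. compact K \<and>
     {\<gamma>. \<forall>x\<in>K. cmod (pair x \<gamma> - pair x \<gamma>0) < \<epsilon>} \<subseteq> U)"
  using dual unfolding is_dual_pairing_def by blast

lemma open_dualE:
  assumes "open U" "\<gamma>0 \<in> U"
  obtains K \<epsilon> where "\<epsilon> > 0" "compact K" "{\<gamma>. \<forall>x\<in>K. cmod (pair x \<gamma> - pair x \<gamma>0) < \<epsilon>} \<subseteq> U"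
proof -
  have "\<exists>K. \<exists>\<epsilon>>0. compact K \<and> {\<gamma>. \<forall>x\<in>K. cmod (pair x \<gamma> - pair x \<gamma>0) < \<epsilon>} \<subseteq> U"
    using assms(1,2) by (subst (asm) open_dual_iff) (rule bspec)
  then show thesis by (elim exE conjE) (rule that)
qed

lemma open_basic_nhd:
  assumes "compact K"
  shows "open {\<gamma>. \<forall>x\<in>K. cmod (pair x \<gamma> - pair x \<gamma>0) < \<epsilon>}" (is "open ?U")
  unfolding open_dual_iff
proof (intro ballI)
  fix \<gamma> assume \<gamma>: "\<gamma> \<in> ?U"
  show "\<exists>K' \<epsilon>'. \<epsilon>' > 0 \<and> compact K' \<and>
     {\<delta>. \<forall>x\<in>K'. cmod (pair x \<delta> - pair x \<gamma>) < \<epsilon>'} \<subseteq> ?U"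
  \<comment> \<open>For empty \<open>K\<close> the set is the whole dual; the maximum taken in the
    other case requires a point of \<open>K\<close>.\<close>
  proof (cases "K = {}")
    case True
    then show ?thesis by (intro exI[of _ "{}"] exI[of _ 1]) simp
  next
    case False
    have "continuous_on K (\<lambda>x. cmod (pair x \<gamma> - pair x \<gamma>0))"
      by (intro continuous_intros continuous_pair_left)
    then obtain x0 where x0: "x0 \<in> K"
      "\<And>x. x \<in> K \<Longrightarrow> cmod (pair x \<gamma> - pair x \<gamma>0) \<le> cmod (pair x0 \<gamma> - pair x0 \<gamma>0)"
      using continuous_attains_sup[OF assms False] by blast
    \<comment> \<open>The strict inequality at the maximum point \<open>x0\<close> leaves a margin
      \<open>r\<close> that is uniform over \<open>K\<close>.\<close>
    define r where "r = \<epsilon> - cmod (pair x0 \<gamma> - pair x0 \<gamma>0)"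
    have "r > 0" using \<gamma> x0 by (simp add: r_def)
    moreover have "{\<delta>. \<forall>x\<in>K. cmod (pair x \<delta> - pair x \<gamma>) < r} \<subseteq> ?U"
    proof safe
      fix \<delta> x assume *: "\<forall>x\<in>K. cmod (pair x \<delta> - pair x \<gamma>) < r" "x \<in> K"
      have "cmod (pair x \<delta> - pair x \<gamma>0)
          \<le> cmod (pair x \<delta> - pair x \<gamma>) + cmod (pair x \<gamma> - pair x \<gamma>0)"
        using norm_triangle_ineq[of "pair x \<delta> - pair x \<gamma>" "pair x \<gamma> - pair x \<gamma>0"] by simp
      also have "\<dots> < \<epsilon>"
        using * x0(2)[of x] unfolding r_def by (smt (verit))
      finally show "cmod (pair x \<delta> - pair x \<gamma>0) < \<epsilon>" .
    qed
    ultimately show ?thesis using assms by blast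
  qed
qed

lemma continuous_pair_right: "continuous_on S (pair x)"
proof -
  have "continuous_on UNIV (pair x)"
    unfolding continuous_on_topological
  proof (intro ballI allI impI)
    fix \<gamma> B assume "open B" "pair x \<gamma> \<in> B"
    then obtain e where e: "e > 0" "\<And>z. dist z (pair x \<gamma>) < e \<Longrightarrow> z \<in> B"
      by (meson open_dist)
    show "\<exists>A. open A \<and> \<gamma> \<in> A \<and> (\<forall>\<delta>\<in>UNIV. \<delta> \<in> A \<longrightarrow> pair x \<delta> \<in> B)"
      using e open_basic_nhd[of "{x}" \<gamma> e]
      by (intro exI[of _ "{\<delta>. \<forall>x\<in>{x}. cmod (pair x \<delta> - pair x \<gamma>) < e}"]) (auto simp: dist_norm)
  qed
  then show ?thesis by (rule continuous_on_subset) simp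
qed

text \<open>Some \<open>x\<close> distinguishes the two characters, and preimages under the
  continuous map \<open>pair x\<close> of disjoint open sets of complex numbers separate them. The
  class of \<open>'g\<close> provides only a topology, so the property is phrased through
  \<open>euclidean\<close>.\<close>

lemma Hausdorff_dual: "Hausdorff_space (euclidean :: 'g topology)"
  unfolding Hausdorff_space_def
proof (intro allI impI)
  fix \<gamma> \<delta> :: 'g
  assume "\<gamma> \<in> topspace euclidean \<and> \<delta> \<in> topspace euclidean \<and> \<gamma> \<noteq> \<delta>"
  then obtain x where "pair x \<gamma> \<noteq> pair x \<delta>"
    using pair_separates by metis
  then obtain A B where AB: "open A" "open B" "pair x \<gamma> \<in> A" "pair x \<delta> \<in> B" "A \<inter> B = {}"
    by (meson hausdorff)
  have "open (pair x -` A)" "open (pair x -` B)"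
    using AB continuous_pair_right[of UNIV x] by (simp_all add: open_vimage)
  then show "\<exists>U W. openin euclidean U \<and> openin euclidean W \<and> \<gamma> \<in> U \<and> \<delta> \<in> W \<and> disjnt U W"
    using AB by (intro exI[of _ "pair x -` A"] exI[of _ "pair x -` B"]) (auto simp: disjnt_def)
qed

lemma compact_imp_closed_dual: "compact K \<Longrightarrow> closed K" for K :: "'g set"
  using compactin_imp_closedin[OF Hausdorff_dual, of K] by simp

text \<open>Since all values have modulus 1, the splitting
  \<open>a b - c d = (a - c) b + c (b - d)\<close> bounds the distance of two products by the sum of
  the distances of their factors, uniformly on \<open>K\<close>.\<close>

lemma continuous_add_dual:
  fixes f g :: "'c::topological_space \<Rightarrow> 'g"
  assumes "continuous_on S f" "continuous_on S g"
  shows "continuous_on S (\<lambda>s. f s + g s)"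
proof -
  have "continuous_on UNIV (\<lambda>p :: 'g \<times> 'g. fst p + snd p)"
    unfolding continuous_on_topological
  proof (intro ballI allI impI)
    fix p :: "'g \<times> 'g" and B assume B: "open B" "fst p + snd p \<in> B"
    obtain K e where K: "e > 0" "compact K"
      "{\<gamma>. \<forall>x\<in>K. cmod (pair x \<gamma> - pair x (fst p + snd p)) < e} \<subseteq> B"
      by (rule open_dualE[OF B])
    let ?U = "\<lambda>\<gamma>0. {\<gamma>. \<forall>x\<in>K. cmod (pair x \<gamma> - pair x \<gamma>0) < e / 2}"
    have "fst q + snd q \<in> B" if q: "q \<in> ?U (fst p) \<times> ?U (snd p)" for q
    proof -
      have "cmod (pair x (fst q + snd q) - pair x (fst p + snd p)) < e" if "x \<in> K" for x
      proof -
        have "pair x (fst q + snd q) - pair x (fst p + snd p)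
            = (pair x (fst q) - pair x (fst p)) * pair x (snd q)
              + pair x (fst p) * (pair x (snd q) - pair x (snd p))"
          by (simp add: pair_add_right algebra_simps)
        also have "cmod \<dots> \<le> cmod (pair x (fst q) - pair x (fst p)) + cmod (pair x (snd q) - pair x (snd p))"
          by (rule norm_triangle_le) (simp add: norm_mult)
        also have "\<dots> < e / 2 + e / 2"
          using q that by (intro add_strict_mono) auto
        finally show ?thesis by simp
      qed
      then show ?thesis using K(3) by blast
    qed
    moreover have "open (?U (fst p) \<times> ?U (snd p))"
      by (intro open_Times open_basic_nhd K)
    moreover have "p \<in> ?U (fst p) \<times> ?U (snd p)"
      using K(1) by (cases p) auto
    ultimately show "\<exists>A. open A \<and> p \<in> A \<and> (\<forall>q\<in>UNIV. q \<in> A \<longrightarrow> fst q + snd q \<in> B)"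
      by blast
  qed
  from continuous_on_compose2[OF this continuous_on_Pair[OF assms]] show ?thesis by simp
qed

text \<open>Negation conjugates the values of a character, and conjugation preserves
  distances.\<close>

lemma continuous_minus_dual:
  fixes f :: "'c::topological_space \<Rightarrow> 'g"
  assumes "continuous_on S f"
  shows "continuous_on S (\<lambda>s. - f s)"
proof -
  have "continuous_on UNIV (uminus :: 'g \<Rightarrow> 'g)"
    unfolding continuous_on_topological
  proof (intro ballI allI impI)
    fix \<gamma> :: 'g and B assume B: "open B" "- \<gamma> \<in> B"
    obtain K e where K: "e > 0" "compact K"
      "{\<delta>. \<forall>x\<in>K. cmod (pair x \<delta> - pair x (- \<gamma>)) < e} \<subseteq> B"
      by (rule open_dualE[OF B])
    let ?U = "{\<delta>. \<forall>x\<in>K. cmod (pair x \<delta> - pair x \<gamma>) < e}"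
    have "cmod (pair x (- \<delta>) - pair x (- \<gamma>)) = cmod (pair x \<delta> - pair x \<gamma>)" for x \<delta>
      by (metis complex_cnj_diff complex_mod_cnj pair_minus_right)
    then have "\<forall>\<delta>\<in>?U. - \<delta> \<in> B"
      using K(3) by auto
    then show "\<exists>A. open A \<and> \<gamma> \<in> A \<and> (\<forall>\<delta>\<in>UNIV. \<delta> \<in> A \<longrightarrow> - \<delta> \<in> B)"
      using open_basic_nhd[OF K(2)] K(1) by (intro exI[of _ ?U]) auto
  qed
  from continuous_on_compose2[OF this assms] show ?thesis by simp
qed

lemma continuous_diff_dual:
  fixes f g :: "'c::topological_space \<Rightarrow> 'g"
  assumes "continuous_on S f" "continuous_on S g"
  shows "continuous_on S (\<lambda>s. f s - g s)"
  using continuous_add_dual[OF assms(1) continuous_minus_dual[OF assms(2)]] by simp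

section \<open>Compact and open sets under sums, differences and translations\<close>

lemma compact_sums_dual:
  fixes A B :: "'g set"
  assumes "compact A" "compact B"
  shows "compact {a + b |a b. a \<in> A \<and> b \<in> B}"
proof -
  have "compact ((\<lambda>p. fst p + snd p) ` (A \<times> B))"
    by (intro compact_continuous_image continuous_add_dual continuous_intros compact_Times assms)
  also have "(\<lambda>p. fst p + snd p) ` (A \<times> B) = {a + b |a b. a \<in> A \<and> b \<in> B}"
    by force
  finally show ?thesis .
qed

lemma compact_diffs_dual:
  fixes A B :: "'g set"
  assumes "compact A" "compact B"
  shows "compact {a - b |a b. a \<in> A \<and> b \<in> B}"
proof -
  have "compact ((\<lambda>p. fst p - snd p) ` (A \<times> B))"
    by (intro compact_continuous_image continuous_diff_dual continuous_intros compact_Times assms)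
  also have "(\<lambda>p. fst p - snd p) ` (A \<times> B) = {a - b |a b. a \<in> A \<and> b \<in> B}"
    by force
  finally show ?thesis .
qed

lemma open_translate_dual:
  fixes U :: "'g set"
  assumes "open U"
  shows "open ((\<lambda>v. v + t) ` U)"
proof -
  have "(\<lambda>v. v + t) ` U = (\<lambda>v. v - t) -` U"
    by force
  moreover have "continuous_on UNIV (\<lambda>v. v - t)"
    by (intro continuous_diff_dual continuous_intros)
  ultimately show ?thesis
    using assms by (simp add: open_vimage)
qed

lemma compact_translate_dual:
  fixes K :: "'g set"
  assumes "compact K"
  shows "compact ((\<lambda>v. v + t) ` K)"
  by (rule compact_continuous_image[OF continuous_add_dual[OF continuous_on_id continuous_on_const] assms])

text \<open>A finite cover of \<open>K\<close> by translates of a set \<open>M\<close> with \<open>M - M \<subseteq> N\<close> bounds the number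
  of points, since each translate of \<open>M\<close> contains at most one of them.\<close>
lemma separated_card_bound:
  fixes K N :: "'g set"
  assumes "compact K" "open N" "0 \<in> N"
  obtains m where "\<And>T \<gamma>. (\<And>s t. s \<in> T \<Longrightarrow> t \<in> T \<Longrightarrow> s \<noteq> t \<Longrightarrow> s - t \<notin> N) \<Longrightarrow>
     T \<subseteq> (\<lambda>v. v + \<gamma>) ` K \<Longrightarrow> finite T \<and> card T \<le> m"
proof -
  have "continuous_on (UNIV :: ('g \<times> 'g) set) (\<lambda>p. fst p - snd p)"
    using continuous_diff_dual[where f = "fst :: 'g \<times> 'g \<Rightarrow> 'g" and g = snd and S = UNIV]
    by (simp add: continuous_on_fst continuous_on_snd)
  then have "open ((\<lambda>p :: 'g \<times> 'g. fst p - snd p) -` N)"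
    by (rule open_vimage[OF assms(2)])
  moreover have "(0, 0) \<in> (\<lambda>p :: 'g \<times> 'g. fst p - snd p) -` N"
    using assms(3) by simp
  ultimately obtain A B where AB: "open A" "open B" "(0, 0) \<in> A \<times> B"
    "A \<times> B \<subseteq> (\<lambda>p :: 'g \<times> 'g. fst p - snd p) -` N"
    by (rule open_prod_elim)
  \<comment> \<open>Intersecting the two sides of a box around \<open>(0, 0)\<close> gives a single
    neighbourhood with \<open>M - M\<close> inside \<open>N\<close>.\<close>
  define M where "M = A \<inter> B"
  have M: "open M" "0 \<in> M"
    using AB by (auto simp: M_def)
  have M_diff: "s - t \<in> N" if "s \<in> M" "t \<in> M" for s t
    using subsetD[OF AB(4), of "(s, t)"] that by (simp add: M_def)
  have "k \<in> (\<lambda>v. v + k) ` M" for k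
    using M(2) by (intro image_eqI[of _ _ 0]) simp_all
  then have "K \<subseteq> (\<Union>k\<in>K. (\<lambda>v. v + k) ` M)"
    by blast
  then obtain C where C: "C \<subseteq> K" "finite C" "K \<subseteq> (\<Union>k\<in>C. (\<lambda>v. v + k) ` M)"
    by (rule compactE_image[OF assms(1) open_translate_dual[OF M(1)]])
  show thesis
  proof (rule that)
    fix T \<gamma>
    assume sep: "\<And>s t. s \<in> T \<Longrightarrow> t \<in> T \<Longrightarrow> s \<noteq> t \<Longrightarrow> s - t \<notin> N"
      and T: "T \<subseteq> (\<lambda>v. v + \<gamma>) ` K"
    have "\<exists>k\<in>C. t - \<gamma> - k \<in> M" if t: "t \<in> T" for t
    proof -
      have "t - \<gamma> \<in> K" using t T by auto
      then obtain k v where "k \<in> C" "v \<in> M" "t - \<gamma> = v + k" using C(3) by blast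
      then show ?thesis by (intro bexI[of _ k]) simp_all
    qed
    then obtain h where h: "\<And>t. t \<in> T \<Longrightarrow> h t \<in> C \<and> t - \<gamma> - h t \<in> M"
      by metis
    \<comment> \<open>Two points in the same translate of \<open>M\<close> differ by an element of
      \<open>M - M\<close>, hence of \<open>N\<close>, against the separation of
      \<open>T\<close>.\<close>
    have "inj_on h T"
    proof (rule inj_onI, rule ccontr)
      fix s t assume "s \<in> T" "t \<in> T" "h s = h t" "s \<noteq> t"
      then show False
        using M_diff[of "s - \<gamma> - h s" "t - \<gamma> - h t"] h[of s] h[of t] sep[of s t] by simp
    qed
    then show "finite T \<and> card T \<le> card C"
      using h C(2) by (meson card_inj_on_le image_subsetI inj_on_finite)
  qed
qed

end

section \<open>The local norms\<close>

text \<open>The coefficients \<open>c\<close> seen as a linear functional on functions of the dual.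
  At \<open>pair x\<close> it gives the value of the trigonometric polynomial at \<open>x\<close>,
  so the constraint and the objective of the local norm are both values of this one
  functional.\<close>

definition coeff_sum :: "('g \<Rightarrow> complex) \<Rightarrow> ('g \<Rightarrow> complex) \<Rightarrow> complex" where
  "coeff_sum c \<phi> = (\<Sum>\<gamma>\<in>{\<gamma>. c \<gamma> \<noteq> 0}. c \<gamma> * \<phi> \<gamma>)"

lemma trig_poly_eq_coeff_sum: "trig_poly pair c x = coeff_sum c (pair x)"
  by (simp add: trig_poly_def coeff_sum_def)

lemma coeff_sum_superset:
  assumes "finite S" "{\<gamma>. c \<gamma> \<noteq> 0} \<subseteq> S"
  shows "coeff_sum c \<phi> = (\<Sum>\<gamma>\<in>S. c \<gamma> * \<phi> \<gamma>)"
  unfolding coeff_sum_def using assms by (intro sum.mono_neutral_left) auto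

lemma coeff_sum_add: "coeff_sum c (\<lambda>\<gamma>. \<phi> \<gamma> + \<psi> \<gamma>) = coeff_sum c \<phi> + coeff_sum c \<psi>"
  by (simp add: coeff_sum_def algebra_simps sum.distrib)

lemma coeff_sum_scale: "coeff_sum c (\<lambda>\<gamma>. a * \<phi> \<gamma>) = a * coeff_sum c \<phi>"
  by (simp add: coeff_sum_def algebra_simps sum_distrib_left)

lemma coeff_sum_scale_left: "coeff_sum (\<lambda>\<gamma>. a * c \<gamma>) \<phi> = a * coeff_sum c \<phi>"
  by (cases "a = 0") (simp_all add: coeff_sum_def algebra_simps sum_distrib_left)

text \<open>Moves a multiplier from the coefficients to the test function, the duality behind
  submultiplicativity. The multiplier may shrink the support, so the sum is kept over the support of
  \<open>c\<close>.\<close>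

lemma coeff_sum_mult:
  assumes "c \<in> coeffs_in E"
  shows "coeff_sum (\<lambda>\<gamma>. c \<gamma> * \<psi> \<gamma>) \<phi> = coeff_sum c (\<lambda>\<gamma>. \<phi> \<gamma> * \<psi> \<gamma>)"
proof -
  have "coeff_sum (\<lambda>\<gamma>. c \<gamma> * \<psi> \<gamma>) \<phi> = (\<Sum>\<gamma>\<in>{\<gamma>. c \<gamma> \<noteq> 0}. c \<gamma> * \<psi> \<gamma> * \<phi> \<gamma>)"
    using assms by (intro coeff_sum_superset) (auto simp: coeffs_in_def)
  then show ?thesis by (simp add: coeff_sum_def algebra_simps)
qed

lemma coeffs_in_mult: "c \<in> coeffs_in E \<Longrightarrow> (\<lambda>\<gamma>. c \<gamma> * \<psi> \<gamma>) \<in> coeffs_in E"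
  by (auto simp: coeffs_in_def elim: rev_finite_subset)

section \<open>Elementary rules for bounds on the local norm\<close>

lemma loc_norm_le_iff:
  "loc_norm pair W \<phi> \<gamma> \<le> ereal C \<longleftrightarrow>
     (\<forall>c\<in>coeffs_in ((\<lambda>v. v + \<gamma>) ` W). (\<forall>x. cmod (coeff_sum c (pair x)) \<le> 1) \<longrightarrow>
        cmod (coeff_sum c \<phi>) \<le> C)"
  by (auto simp: loc_norm_def SUP_le_iff trig_poly_eq_coeff_sum coeff_sum_def)

lemma loc_normD:
  assumes "loc_norm pair W \<phi> \<gamma> \<le> ereal C" "c \<in> coeffs_in ((\<lambda>v. v + \<gamma>) ` W)"
    "\<And>x. cmod (coeff_sum c (pair x)) \<le> 1"
  shows "cmod (coeff_sum c \<phi>) \<le> C"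
  using assms by (auto simp: loc_norm_le_iff)

lemma loc_normI:
  assumes "\<And>c. c \<in> coeffs_in ((\<lambda>v. v + \<gamma>) ` W) \<Longrightarrow> (\<And>x. cmod (coeff_sum c (pair x)) \<le> 1) \<Longrightarrow>
    cmod (coeff_sum c \<phi>) \<le> C"
  shows "loc_norm pair W \<phi> \<gamma> \<le> ereal C"
  using assms by (auto simp: loc_norm_le_iff)

lemma loc_norm_nonneg: "0 \<le> loc_norm pair W \<phi> \<gamma>"
  unfolding loc_norm_def
  by (rule SUP_upper2[of "\<lambda>_. 0"]) (auto simp: trig_poly_def coeffs_in_def)

lemma loc_norm_bound_nonneg: "loc_norm pair W \<phi> \<gamma> \<le> ereal C \<Longrightarrow> 0 \<le> C"
  using loc_norm_nonneg[of pair W \<phi> \<gamma>] by (metis ereal_less_eq(5) order_trans)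

text \<open>Admissible coefficients at \<gamma> live on \<open>W + \<gamma>\<close>, so values
  elsewhere are invisible. This locality is what allows functions to be cut off without changing
  their norms.\<close>

lemma loc_norm_cong:
  assumes "\<And>w. w \<in> W \<Longrightarrow> \<phi> (w + \<gamma>) = \<psi> (w + \<gamma>)"
  shows "loc_norm pair W \<phi> \<gamma> = loc_norm pair W \<psi> \<gamma>"
proof -
  have "coeff_sum c \<phi> = coeff_sum c \<psi>" if "c \<in> coeffs_in ((\<lambda>v. v + \<gamma>) ` W)" for c
    unfolding coeff_sum_def using that assms by (intro sum.cong) (auto simp: coeffs_in_def)
  then show ?thesis
    unfolding loc_norm_def by (intro SUP_cong refl) (simp flip: coeff_sum_def)
qed

lemma loc_norm_add:
  assumes "loc_norm pair W \<phi> \<gamma> \<le> ereal C" "loc_norm pair W \<psi> \<gamma> \<le> ereal D"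
  shows "loc_norm pair W (\<lambda>\<gamma>. \<phi> \<gamma> + \<psi> \<gamma>) \<gamma> \<le> ereal (C + D)"
proof (rule loc_normI)
  fix c assume c: "c \<in> coeffs_in ((\<lambda>v. v + \<gamma>) ` W)" "\<And>x. cmod (coeff_sum c (pair x)) \<le> 1"
  show "cmod (coeff_sum c (\<lambda>\<gamma>. \<phi> \<gamma> + \<psi> \<gamma>)) \<le> C + D"
    unfolding coeff_sum_add
    using loc_normD[OF assms(1) c] loc_normD[OF assms(2) c] by (rule norm_triangle_mono)
qed

lemma loc_norm_scale:
  assumes "loc_norm pair W \<phi> \<gamma> \<le> ereal C"
  shows "loc_norm pair W (\<lambda>\<gamma>. a * \<phi> \<gamma>) \<gamma> \<le> ereal (cmod a * C)"
proof (rule loc_normI)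
  fix c assume c: "c \<in> coeffs_in ((\<lambda>v. v + \<gamma>) ` W)" "\<And>x. cmod (coeff_sum c (pair x)) \<le> 1"
  show "cmod (coeff_sum c (\<lambda>\<gamma>. a * \<phi> \<gamma>)) \<le> cmod a * C"
    unfolding coeff_sum_scale norm_mult
    using loc_normD[OF assms c] by (intro mult_left_mono) auto
qed

lemma loc_norm_diff:
  assumes "loc_norm pair W \<phi> \<gamma> \<le> ereal C" "loc_norm pair W \<psi> \<gamma> \<le> ereal D"
  shows "loc_norm pair W (\<lambda>\<gamma>. \<phi> \<gamma> - \<psi> \<gamma>) \<gamma> \<le> ereal (C + D)"
  using loc_norm_add[OF assms(1) loc_norm_scale[OF assms(2), of "-1"]] by simp

lemma loc_norm_zero: "loc_norm pair W (\<lambda>_. 0) \<gamma> \<le> ereal 0"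
  by (rule loc_normI) (simp add: coeff_sum_def)

text \<open>Each functional involves finitely many points and is therefore continuous under
  pointwise convergence.\<close>

lemma loc_norm_limit:
  assumes lim: "\<And>\<delta>. (\<lambda>n. \<phi> n \<delta>) \<longlonglongrightarrow> \<psi> \<delta>"
    and bound: "\<forall>\<^sub>F n in sequentially. loc_norm pair W (\<phi> n) \<gamma> \<le> ereal C"
  shows "loc_norm pair W \<psi> \<gamma> \<le> ereal C"
proof (rule loc_normI)
  fix c assume c: "c \<in> coeffs_in ((\<lambda>v. v + \<gamma>) ` W)" "\<And>x. cmod (coeff_sum c (pair x)) \<le> 1"
  have "(\<lambda>n. cmod (coeff_sum c (\<phi> n))) \<longlonglongrightarrow> cmod (coeff_sum c \<psi>)"
    unfolding coeff_sum_def by (intro tendsto_intros lim)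
  moreover have "\<forall>\<^sub>F n in sequentially. cmod (coeff_sum c (\<phi> n)) \<le> C"
    using bound by eventually_elim (rule loc_normD[OF _ c])
  ultimately show "cmod (coeff_sum c \<psi>) \<le> C"
    by (intro tendsto_upperbound) auto
qed

text \<open>Homogeneity in the polynomial: scaling by \<open>1 / (M + e)\<close> makes it
  admissible, and \<open>e\<close> then tends to 0. The summand \<open>e\<close> keeps the factor
  finite when \<open>M = 0\<close>.\<close>

lemma coeff_sum_le_scaled:
  assumes \<phi>: "loc_norm pair W \<phi> \<gamma> \<le> ereal C" and c: "c \<in> coeffs_in ((\<lambda>v. v + \<gamma>) ` W)"
    and M: "\<And>x. cmod (coeff_sum c (pair x)) \<le> M"
  shows "cmod (coeff_sum c \<phi>) \<le> C * M"
proof -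
  have M0: "0 \<le> M" using M norm_ge_zero order_trans by blast
  have *: "cmod (coeff_sum c \<phi>) \<le> C * (M + e)" if "e > 0" for e
  proof -
    define r where "r = 1 / (M + e)"
    have r: "r > 0" "r * (M + e) = 1" using M0 that by (simp_all add: r_def)
    let ?c = "\<lambda>\<gamma>. complex_of_real r * c \<gamma>"
    have "cmod (coeff_sum ?c \<phi>) \<le> C"
    proof (rule loc_normD[OF \<phi>])
      show "?c \<in> coeffs_in ((\<lambda>v. v + \<gamma>) ` W)"
        using coeffs_in_mult[OF c, of "\<lambda>_. complex_of_real r"] by (simp add: mult.commute)
      show "cmod (coeff_sum ?c (pair x)) \<le> 1" for x
      proof -
        have "r * cmod (coeff_sum c (pair x)) \<le> r * (M + e)"
          using M[of x] that r(1) by (intro mult_left_mono) auto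
        then show ?thesis using r unfolding coeff_sum_scale_left norm_mult by simp
      qed
    qed
    then have "r * cmod (coeff_sum c \<phi>) \<le> C"
      using r unfolding coeff_sum_scale_left norm_mult by simp
    then have "r * cmod (coeff_sum c \<phi>) * (M + e) \<le> C * (M + e)"
      using M0 that by (intro mult_right_mono) auto
    then show ?thesis
      using r(2) by (metis mult.assoc mult.commute mult_1)
  qed
  have "((\<lambda>e. C * (M + e)) \<longlongrightarrow> C * (M + 0)) (at_right 0)"
    by (intro tendsto_intros)
  then show ?thesis
    using * by (intro tendsto_lowerbound[of "\<lambda>e. C * (M + e)" _ "at_right 0"])
      (auto simp: eventually_at_right_less intro: eventually_at_rightI[of _ 1])
qed

section \<open>Consequences of the character property: products, translations and pointwise
  bounds\<close>

context dual_pairing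
begin

text \<open>On \<open>pair x\<close> the functional returns the value of the polynomial at
  \<open>x\<close>, which admissibility bounds by 1.\<close>

lemma loc_norm_char: "loc_norm pair W (pair x) \<gamma> \<le> ereal 1"
  by (rule loc_normI)

lemma loc_norm_one: "loc_norm pair W (\<lambda>_. 1) \<gamma> \<le> ereal 1"
proof -
  have "pair 0 = (\<lambda>_. 1)" by (rule ext) simp
  then show ?thesis using loc_norm_char[of W 0 \<gamma>] by simp
qed

lemma loc_norm_const: "loc_norm pair W (\<lambda>_. a) \<gamma> \<le> ereal (cmod a)"
  using loc_norm_scale[OF loc_norm_one[of W \<gamma>], of a] by simp

text \<open>Multiplying the coefficients of \<open>p\<close> by \<open>(x,\<cdot>)\<close> translates \<open>p\<close> by \<open>x\<close>; hence the polynomial with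
  coefficients \<open>c \<psi>\<close> is bounded by the local norm of \<open>\<psi>\<close>.\<close>
lemma loc_norm_mult:
  assumes \<phi>: "loc_norm pair W \<phi> \<gamma> \<le> ereal C" and \<psi>: "loc_norm pair W \<psi> \<gamma> \<le> ereal D"
  shows "loc_norm pair W (\<lambda>\<gamma>. \<phi> \<gamma> * \<psi> \<gamma>) \<gamma> \<le> ereal (C * D)"
proof (rule loc_normI)
  fix c assume c: "c \<in> coeffs_in ((\<lambda>v. v + \<gamma>) ` W)" "\<And>x. cmod (coeff_sum c (pair x)) \<le> 1"
  have "cmod (coeff_sum (\<lambda>\<gamma>. c \<gamma> * \<psi> \<gamma>) (pair x)) \<le> D" for x
  proof -
    have "coeff_sum (\<lambda>\<gamma>. c \<gamma> * pair x \<gamma>) (pair y) = coeff_sum c (pair (y + x))" for y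
    proof -
      have "pair (y + x) = (\<lambda>\<gamma>. pair y \<gamma> * pair x \<gamma>)" by (rule ext) (rule pair_add_left)
      then show ?thesis by (simp add: coeff_sum_mult[OF c(1)])
    qed
    then have "cmod (coeff_sum (\<lambda>\<gamma>. c \<gamma> * pair x \<gamma>) \<psi>) \<le> D"
      using c(2) by (intro loc_normD[OF \<psi>] coeffs_in_mult[OF c(1)]) simp
    then show ?thesis
      unfolding coeff_sum_mult[OF c(1)] by (simp only: mult.commute)
  qed
  then have "cmod (coeff_sum (\<lambda>\<gamma>. c \<gamma> * \<psi> \<gamma>) \<phi>) \<le> C * D"
    by (rule coeff_sum_le_scaled[OF \<phi> coeffs_in_mult[OF c(1)]])
  then show "cmod (coeff_sum c (\<lambda>\<gamma>. \<phi> \<gamma> * \<psi> \<gamma>)) \<le> C * D"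
    by (simp add: coeff_sum_mult[OF c(1)])
qed

lemma loc_norm_prod:
  assumes "\<And>i. i \<in> I \<Longrightarrow> loc_norm pair W (\<phi> i) \<gamma> \<le> ereal (C i)"
  shows "loc_norm pair W (\<lambda>\<gamma>. \<Prod>i\<in>I. \<phi> i \<gamma>) \<gamma> \<le> ereal (\<Prod>i\<in>I. C i)"
  using assms
proof (induction I rule: infinite_finite_induct)
  case (insert i I)
  then show ?case
    using loc_norm_mult[of W "\<phi> i" \<gamma> "C i" "\<lambda>\<gamma>. \<Prod>i\<in>I. \<phi> i \<gamma>" "\<Prod>i\<in>I. C i"] by simp
qed (simp_all add: loc_norm_one)

text \<open>Shifting the coefficients by \<open>t\<close> multiplies the polynomial by
  \<open>pair x (- t)\<close>, a factor of modulus 1, and so preserves its supremum norm.\<close>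

lemma loc_norm_translate:
  assumes "loc_norm pair W \<phi> (\<gamma> - t) \<le> ereal C"
  shows "loc_norm pair W (\<lambda>\<gamma>. \<phi> (\<gamma> - t)) \<gamma> \<le> ereal C"
proof (rule loc_normI)
  fix c assume c: "c \<in> coeffs_in ((\<lambda>v. v + \<gamma>) ` W)" "\<And>x. cmod (coeff_sum c (pair x)) \<le> 1"
  let ?c = "\<lambda>\<delta>. c (\<delta> + t)"
  have supp: "{\<delta>. ?c \<delta> \<noteq> 0} = (\<lambda>\<delta>. \<delta> - t) ` {\<delta>. c \<delta> \<noteq> 0}"
  proof (intro equalityI subsetI)
    fix \<delta> assume "\<delta> \<in> {\<delta>. ?c \<delta> \<noteq> 0}"
    then show "\<delta> \<in> (\<lambda>\<delta>. \<delta> - t) ` {\<delta>. c \<delta> \<noteq> 0}"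
      by (intro image_eqI[of _ _ "\<delta> + t"]) simp_all
  qed auto
  have sum: "coeff_sum ?c \<psi> = coeff_sum c (\<lambda>\<delta>. \<psi> (\<delta> - t))" for \<psi>
    unfolding coeff_sum_def supp by (subst sum.reindex) (auto simp: inj_on_def)
  have "cmod (coeff_sum ?c \<phi>) \<le> C"
  proof (rule loc_normD[OF assms])
    show "?c \<in> coeffs_in ((\<lambda>v. v + (\<gamma> - t)) ` W)"
    proof -
      have "\<delta> - t \<in> (\<lambda>v. v + (\<gamma> - t)) ` W" if nz: "c \<delta> \<noteq> 0" for \<delta>
      proof -
        obtain w where "w \<in> W" "\<delta> = w + \<gamma>"
          using c(1) nz unfolding coeffs_in_def by blast
        then show ?thesis by (intro image_eqI[of _ _ w]) simp_all
      qed
      then show ?thesis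
        using c(1) unfolding coeffs_in_def mem_Collect_eq supp by blast
    qed
    show "cmod (coeff_sum ?c (pair x)) \<le> 1" for x
    proof -
      have "coeff_sum ?c (pair x) = coeff_sum c (\<lambda>\<delta>. pair x (- t) * pair x \<delta>)"
        unfolding sum using pair_add_right[of x _ "- t"] by (simp add: mult.commute)
      then show ?thesis
        using c(2)[of x] by (simp add: coeff_sum_scale norm_mult)
    qed
  qed
  then show "cmod (coeff_sum c (\<lambda>\<gamma>. \<phi> (\<gamma> - t))) \<le> C"
    by (simp add: sum)
qed

text \<open>The single character \<gamma> is an admissible polynomial, because
  \<open>0 \<in> W\<close> places \<gamma> in \<open>W + \<gamma>\<close>.\<close>

lemma cmod_le_loc_norm:
  assumes "loc_norm pair W \<phi> \<gamma> \<le> ereal C" "0 \<in> W"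
  shows "cmod (\<phi> \<gamma>) \<le> C"
proof -
  let ?c = "\<lambda>\<delta>. if \<delta> = \<gamma> then 1 else 0 :: complex"
  have sum: "coeff_sum ?c \<psi> = \<psi> \<gamma>" for \<psi>
    by (simp add: coeff_sum_def)
  have "?c \<in> coeffs_in ((\<lambda>v. v + \<gamma>) ` W)"
    using assms(2) by (auto simp: coeffs_in_def intro!: image_eqI[of _ _ 0])
  then show ?thesis
    using loc_normD[OF assms(1), of ?c] by (simp add: sum)
qed

end

section \<open>Bump functions on the dual group\<close>

text \<open>The sequence increases from 0 and stays below the fixed point \<open>1 - s\<close>. Its
  limit \<open>l\<close> is a fixed point, that is \<open>(1 - l)^2 = s^2\<close>, and the upper
  bound selects the smaller root.\<close>

lemma sqrt_iteration:
  fixes r :: real and q :: "nat \<Rightarrow> real"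
  assumes r: "\<bar>r\<bar> \<le> 1" and q0: "q 0 = 0" and qSuc: "\<And>n. q (Suc n) = (r\<^sup>2 + (q n)\<^sup>2) / 2"
  shows "q \<longlonglongrightarrow> 1 - sqrt (1 - r\<^sup>2)"
proof -
  define s where "s = sqrt (1 - r\<^sup>2)"
  have r2: "r\<^sup>2 \<le> 1" using r by (simp add: abs_square_le_1)
  then have s: "0 \<le> s" "s \<le> 1" "s\<^sup>2 = 1 - r\<^sup>2" by (simp_all add: s_def)
  have bounds: "0 \<le> q n \<and> q n \<le> 1 - s" for n
  proof (induction n)
    case (Suc n)
    then have "(q n)\<^sup>2 \<le> (1 - s)\<^sup>2" by (intro power_mono) auto
    then have "q (Suc n) \<le> (r\<^sup>2 + (1 - s)\<^sup>2) / 2" unfolding qSuc by simp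
    also have "\<dots> = 1 - s" using s(3) by (simp add: power2_diff)
    finally show ?case by (simp add: qSuc)
  qed (simp add: q0 s)
  have "q n \<le> q (Suc n)" for n
  proof -
    \<comment> \<open>With \<open>s^2 = 1 - r^2\<close> this inequality is
      \<open>q n \<le> (r^2 + (q n)^2) / 2\<close> after completing the square.\<close>
    have "s\<^sup>2 \<le> (1 - q n)\<^sup>2" using bounds[of n] s(1) by (intro power_mono) auto
    then show ?thesis unfolding qSuc using s(3) by (simp add: power2_diff)
  qed
  then have "incseq q" by (intro incseq_SucI)
  then obtain l where l: "q \<longlonglongrightarrow> l" "\<And>n. q n \<le> l"
    using incseq_convergent[of q "1 - s"] bounds by blast
  have "(\<lambda>n. q (Suc n)) \<longlonglongrightarrow> (r\<^sup>2 + l\<^sup>2) / 2"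
    unfolding qSuc by (intro tendsto_intros l) simp
  then have "l = (r\<^sup>2 + l\<^sup>2) / 2"
    using LIMSEQ_Suc[OF l(1)] LIMSEQ_unique by blast
  then have "(1 - l)\<^sup>2 = s\<^sup>2" using s(3) by (simp add: power2_diff)
  moreover have "l \<le> 1 - s" using l(1) bounds by (intro LIMSEQ_le_const2) auto
  ultimately have "1 - l = s" using power2_eq_imp_eq[of "1 - l" s] s(1) by linarith
  then have "l = 1 - s" by linarith
  then show ?thesis using l(1) unfolding s_def by simp
qed

text \<open>Writing \<open>x = cos t\<close>, \<open>y = sin t\<close>, \<open>c = cos u\<close>,
  \<open>s = sin u\<close>, the factors are the positive parts of \<open>sin (u + t)\<close> and
  \<open>sin (u - t)\<close>, and the product of these sines is \<open>cos^2 t - cos^2 u\<close>.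
  The sign of their sum \<open>2 s x\<close> decides which signs can occur.\<close>

lemma max_mult_max_unit:
  fixes x y c s :: real
  assumes xy: "x\<^sup>2 + y\<^sup>2 = 1" and cs: "c\<^sup>2 + s\<^sup>2 = 1" and c: "0 \<le> c" and s: "0 < s"
  shows "max 0 (s * x + c * y) * max 0 (s * x - c * y) = (if c \<le> x then x\<^sup>2 - c\<^sup>2 else 0)"
proof -
  have prod: "(s * x + c * y) * (s * x - c * y) = x\<^sup>2 - c\<^sup>2"
  proof -
    have "(s * x + c * y) * (s * x - c * y) = s\<^sup>2 * x\<^sup>2 - c\<^sup>2 * y\<^sup>2"
      by (simp add: algebra_simps power2_eq_square)
    also have "\<dots> = (1 - c\<^sup>2) * x\<^sup>2 - c\<^sup>2 * (1 - x\<^sup>2)"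
    proof -
      have "s\<^sup>2 = 1 - c\<^sup>2" "y\<^sup>2 = 1 - x\<^sup>2" using xy cs by linarith+
      then show ?thesis by simp
    qed
    finally show ?thesis by (simp add: algebra_simps)
  qed
  show ?thesis
  proof (cases "c \<le> x")
    case True
    have "0 \<le> s * x" using True c s by simp
    moreover have "0 \<le> (s * x + c * y) * (s * x - c * y)"
      using True c unfolding prod by (simp add: power_mono)
    \<comment> \<open>A non-negative product leaves two factors of the same sign, and their sum
      \<open>2 s x\<close> is non-negative.\<close>
    ultimately have "0 \<le> s * x + c * y \<and> 0 \<le> s * x - c * y"
      unfolding zero_le_mult_iff[of "s * x + c * y"] by linarith
    then show ?thesis using True prod by (simp add: max_absorb2)
  next
    case False
    have "\<not> (0 < s * x + c * y \<and> 0 < s * x - c * y)"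
    proof
      assume *: "0 < s * x + c * y \<and> 0 < s * x - c * y"
      then have "0 < s * x" by linarith
      then have "0 < x" using s by (simp add: zero_less_mult_iff)
      then have "x\<^sup>2 < c\<^sup>2" using False by (intro power_strict_mono) auto
      moreover have "0 < x\<^sup>2 - c\<^sup>2" unfolding prod[symmetric] using * by (intro mult_pos_pos) auto
      ultimately show False by simp
    qed
    then show ?thesis using False by (auto simp: max_def)
  qed
qed

section \<open>From square roots and positive parts of characters to bumps\<close>

context dual_pairing
begin

text \<open>The iteration \<open>q \<mapsto> (r\<^sup>2 + q\<^sup>2) / 2\<close> preserves the unit ball and converges to \<open>1 - \<surd>(1 - r\<^sup>2)\<close>.\<close>
lemma loc_norm_sqrt:
  assumes r: "\<And>\<delta>. \<bar>r \<delta>\<bar> \<le> 1" and norm: "loc_norm pair W (\<lambda>\<delta>. complex_of_real (r \<delta>)) \<gamma> \<le> ereal 1"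
  shows "loc_norm pair W (\<lambda>\<delta>. complex_of_real (sqrt (1 - (r \<delta>)\<^sup>2))) \<gamma> \<le> ereal 2"
proof -
  define q where "q n \<delta> = ((\<lambda>t. ((r \<delta>)\<^sup>2 + t\<^sup>2) / 2) ^^ n) 0" for n \<delta>
  have q: "q 0 \<delta> = 0" "q (Suc n) \<delta> = ((r \<delta>)\<^sup>2 + (q n \<delta>)\<^sup>2) / 2" for n \<delta>
    by (simp_all add: q_def)
  have "loc_norm pair W (\<lambda>\<delta>. complex_of_real (q n \<delta>)) \<gamma> \<le> ereal 1" for n
  proof (induction n)
    case 0
    show ?case
      using order_trans[OF loc_norm_zero[of pair W \<gamma>], of "ereal 1"] by (simp add: q)
  next
    case (Suc n)
    \<comment> \<open>The unit ball is preserved because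
      \<open>(1 * 1 + 1 * 1) / 2 = 1\<close>.\<close>
    from loc_norm_scale[OF loc_norm_add[OF loc_norm_mult[OF norm norm] loc_norm_mult[OF Suc Suc]], of "1/2"]
    show ?case by (simp add: q power2_eq_square)
  qed
  moreover have "(\<lambda>n. complex_of_real (q n \<delta>)) \<longlonglongrightarrow> complex_of_real (1 - sqrt (1 - (r \<delta>)\<^sup>2))" for \<delta>
    by (intro tendsto_of_real sqrt_iteration) (simp_all add: r q)
  ultimately have "loc_norm pair W (\<lambda>\<delta>. complex_of_real (1 - sqrt (1 - (r \<delta>)\<^sup>2))) \<gamma> \<le> ereal 1"
    by (intro loc_norm_limit[of "\<lambda>n \<delta>. complex_of_real (q n \<delta>)"]) auto
  from loc_norm_diff[OF loc_norm_one this] show ?thesis by simp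
qed

text \<open>The real part is the mean of the function and its conjugate, and the conjugate of
  \<open>pair x\<close> is the character function \<open>pair (- x)\<close>.\<close>

lemma loc_norm_Re:
  assumes "cmod w = 1"
  shows "loc_norm pair W (\<lambda>\<delta>. complex_of_real (Re (w * pair x \<delta>))) \<gamma> \<le> ereal 1"
proof -
  have eq: "(\<lambda>\<delta>. complex_of_real (Re (w * pair x \<delta>)))
      = (\<lambda>\<delta>. (1/2) * (w * pair x \<delta> + cnj w * pair (- x) \<delta>))"
    by (rule ext) (simp add: pair_minus_left complex_eq_iff)
  have "loc_norm pair W (\<lambda>\<delta>. (1/2) * (w * pair x \<delta> + cnj w * pair (- x) \<delta>)) \<gamma>
      \<le> ereal (cmod (1/2) * (cmod w * 1 + cmod (cnj w) * 1))"
    by (intro loc_norm_scale loc_norm_add loc_norm_char)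
  then show ?thesis unfolding eq using assms by simp
qed

text \<open>On the unit circle the absolute value of the imaginary part is
  \<open>sqrt (1 - Re^2)\<close>, of norm at most 2. The positive part is the mean of the imaginary
  part and its absolute value, whence \<open>(1 + 2) / 2\<close>.\<close>

lemma loc_norm_max_Im:
  assumes w: "cmod w = 1"
  shows "loc_norm pair W (\<lambda>\<delta>. complex_of_real (max 0 (Im (w * pair x \<delta>)))) \<gamma> \<le> ereal (3/2)"
proof -
  have Im: "loc_norm pair W (\<lambda>\<delta>. complex_of_real (Im (w * pair x \<delta>))) \<gamma> \<le> ereal 1"
    using loc_norm_Re[of "- \<i> * w" W x \<gamma>] w by (simp add: norm_mult)
  have "sqrt (1 - (Re (w * pair x \<delta>))\<^sup>2) = \<bar>Im (w * pair x \<delta>)\<bar>" for \<delta>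
  proof -
    have "(Re (w * pair x \<delta>))\<^sup>2 + (Im (w * pair x \<delta>))\<^sup>2 = 1"
      using w by (metis cmod_pair cmod_power2 mult_1 norm_mult one_power2)
    then have "1 - (Re (w * pair x \<delta>))\<^sup>2 = (Im (w * pair x \<delta>))\<^sup>2" by simp
    then show ?thesis by (simp only: real_sqrt_abs)
  qed
  moreover have "\<bar>Re (w * pair x \<delta>)\<bar> \<le> 1" for \<delta>
    using abs_Re_le_cmod[of "w * pair x \<delta>"] w by (simp add: norm_mult)
  ultimately have abs: "loc_norm pair W (\<lambda>\<delta>. complex_of_real \<bar>Im (w * pair x \<delta>)\<bar>) \<gamma> \<le> ereal 2"
    using loc_norm_sqrt[OF _ loc_norm_Re[OF w], of x W \<gamma>] by simp
  have eq: "(\<lambda>\<delta>. complex_of_real (max 0 (Im (w * pair x \<delta>)))) =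
      (\<lambda>\<delta>. (1/2) * (complex_of_real (Im (w * pair x \<delta>)) + complex_of_real \<bar>Im (w * pair x \<delta>)\<bar>))"
    by (rule ext) (simp add: max_def)
  show ?thesis
    unfolding eq using loc_norm_scale[OF loc_norm_add[OF Im abs], of "1/2"] by simp
qed

text \<open>The clipped function is a product of two positive parts, for \<open>x\<close> and for
  \<open>- x\<close>, both rotated by \<open>Complex c s\<close>. Each factor has norm at most
  \<open>3/2\<close>.\<close>

lemma loc_norm_arc:
  assumes "0 \<le> c" "c < 1"
  shows "loc_norm pair W (\<lambda>\<delta>. complex_of_real
      (if c \<le> Re (pair x \<delta>) then (Re (pair x \<delta>))\<^sup>2 - c\<^sup>2 else 0)) \<gamma> \<le> ereal (9/4)"
proof -
  define s where "s = sqrt (1 - c\<^sup>2)"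
  have "c\<^sup>2 < 1" using assms by (simp add: abs_square_less_1)
  then have s: "s > 0" "c\<^sup>2 + s\<^sup>2 = 1" by (simp_all add: s_def)
  have w: "cmod (Complex c s) = 1" using s by (simp add: complex_norm)
  have unit: "(Re (pair x \<delta>))\<^sup>2 + (Im (pair x \<delta>))\<^sup>2 = 1" for \<delta>
    by (metis cmod_pair cmod_power2 one_power2)
  have eq: "(\<lambda>\<delta>. complex_of_real (if c \<le> Re (pair x \<delta>) then (Re (pair x \<delta>))\<^sup>2 - c\<^sup>2 else 0))
      = (\<lambda>\<delta>. complex_of_real (max 0 (Im (Complex c s * pair x \<delta>)))
          * complex_of_real (max 0 (Im (Complex c s * pair (- x) \<delta>))))" (is "?l = ?r")
  proof
    fix \<delta>
    show "?l \<delta> = ?r \<delta>"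
      using max_mult_max_unit[OF unit s(2) assms(1) s(1), of \<delta>]
      unfolding of_real_mult[symmetric] by (simp add: pair_minus_left add.commute)
  qed
  have num: "9/4 = 3/2 * (3/2 :: real)" by simp
  show ?thesis
    unfolding eq num by (intro loc_norm_mult loc_norm_max_Im w)
qed

text \<open>Two clipped functions with thresholds \<open>a < b\<close> both vanish where the real
  part is below \<open>a\<close> and differ by the constant \<open>b^2 - a^2\<close> where it
  exceeds \<open>b\<close>. Dividing their difference by that constant gives the bump; its bound
  depends on neither \<open>W\<close> nor \<gamma>.\<close>

lemma bump_separating:
  assumes "pair x \<gamma>0 \<noteq> 1"
  obtains F C N M where "continuous_on UNIV F" "\<And>W \<gamma>. loc_norm pair W F \<gamma> \<le> ereal C"
    "open N" "0 \<in> N" "\<And>\<gamma>. \<gamma> \<in> N \<Longrightarrow> F \<gamma> = 1" "open M" "\<gamma>0 \<in> M" "\<And>\<gamma>. \<gamma> \<in> M \<Longrightarrow> F \<gamma> = 0"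
proof -
  \<comment> \<open>The maximum with 0 keeps the thresholds non-negative; \<open>a\<close> and
    \<open>b\<close> divide the gap between \<open>m\<close> and 1 into thirds.\<close>
  define m where "m = max 0 (Re (pair x \<gamma>0))"
  define a where "a = (2 * m + 1) / 3"
  define b where "b = (m + 2) / 3"
  have "Re (pair x \<gamma>0) < 1"
  proof (rule ccontr)
    assume "\<not> Re (pair x \<gamma>0) < 1"
    then have "Re (pair x \<gamma>0) = 1"
      using complex_Re_le_cmod[of "pair x \<gamma>0"] by simp
    moreover from this have "Im (pair x \<gamma>0) = 0"
      using cmod_power2[of "pair x \<gamma>0"] by simp
    ultimately show False using assms by (simp add: complex_eq_iff)
  qed
  then have m: "0 \<le> m" "m < 1" "Re (pair x \<gamma>0) \<le> m" by (auto simp: m_def)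
  then have ab: "0 \<le> a" "a < b" "b < 1" "Re (pair x \<gamma>0) < a"
    by (auto simp: a_def b_def)
  then have ab2: "a\<^sup>2 < b\<^sup>2" by (simp add: power_strict_mono)
  define Q where "Q c \<gamma> = complex_of_real (if c \<le> Re (pair x \<gamma>) then (Re (pair x \<gamma>))\<^sup>2 - c\<^sup>2 else 0)" for c \<gamma>
  \<comment> \<open>This form of \<open>Q\<close> makes its continuity visible.\<close>
  have Q_max: "Q c \<gamma> = complex_of_real ((max c (Re (pair x \<gamma>)))\<^sup>2 - c\<^sup>2)" for c \<gamma>
    by (auto simp: Q_def max_def)
  define d where "d = complex_of_real (1 / (b\<^sup>2 - a\<^sup>2))"
  define F where "F \<gamma> = d * (Q a \<gamma> - Q b \<gamma>)" for \<gamma>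
  show thesis
  proof (rule that)
    show "continuous_on UNIV F"
      unfolding F_def Q_max by (intro continuous_intros continuous_pair_right)
    show "loc_norm pair W F \<gamma> \<le> ereal (cmod d * (9/4 + 9/4))" for W \<gamma>
      unfolding F_def[abs_def] Q_def
      using ab by (intro loc_norm_scale loc_norm_diff loc_norm_arc) auto
    show "open {\<gamma>. b < Re (pair x \<gamma>)}" "open {\<gamma>. Re (pair x \<gamma>) < a}"
      by (intro open_Collect_less continuous_intros continuous_pair_right)+
    show "0 \<in> {\<gamma>. b < Re (pair x \<gamma>)}" "\<gamma>0 \<in> {\<gamma>. Re (pair x \<gamma>) < a}"
      using ab by simp_all
    show "F \<gamma> = 1" if "\<gamma> \<in> {\<gamma>. b < Re (pair x \<gamma>)}" for \<gamma>
    proof -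
      have "Q a \<gamma> - Q b \<gamma> = complex_of_real (b\<^sup>2 - a\<^sup>2)" using that ab by (simp add: Q_def)
      then have "F \<gamma> = complex_of_real (1 / (b\<^sup>2 - a\<^sup>2) * (b\<^sup>2 - a\<^sup>2))"
        unfolding F_def d_def by (simp only: of_real_mult)
      also have "1 / (b\<^sup>2 - a\<^sup>2) * (b\<^sup>2 - a\<^sup>2) = 1" using ab2 by simp
      finally show ?thesis by simp
    qed
    show "F \<gamma> = 0" if "\<gamma> \<in> {\<gamma>. Re (pair x \<gamma>) < a}" for \<gamma>
      using that ab by (simp add: F_def Q_def)
  qed
qed

text \<open>Finitely many of the open sets on which separating bumps vanish cover \<open>L\<close>.
  The product of these bumps vanishes on \<open>L\<close> and is 1 on a finite intersection of
  neighbourhoods of 0.\<close>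

lemma bump_vanishing_on_compact:
  assumes "compact L" "0 \<notin> L"
  obtains F C N where "continuous_on UNIV F" "\<And>W \<gamma>. loc_norm pair W F \<gamma> \<le> ereal C"
    "open N" "0 \<in> N" "\<And>\<gamma>. \<gamma> \<in> N \<Longrightarrow> F \<gamma> = 1" "\<And>\<gamma>. \<gamma> \<in> L \<Longrightarrow> F \<gamma> = 0"
proof -
  \<comment> \<open>Collecting all properties in one predicate allows the bumps to be chosen as
    functions of the point.\<close>
  define P where "P l F C N M \<longleftrightarrow> continuous_on UNIV F \<and> (\<forall>W \<gamma>. loc_norm pair W F \<gamma> \<le> ereal C) \<and>
      open N \<and> 0 \<in> N \<and> (\<forall>\<gamma>\<in>N. F \<gamma> = 1) \<and> open M \<and> l \<in> M \<and> (\<forall>\<gamma>\<in>M. F \<gamma> = 0)" for l F C N M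
  have "\<exists>F C N M. P l F C N M" if "l \<in> L" for l
  proof -
    have "l \<noteq> 0" using that assms(2) by blast
    then obtain x where "pair x l \<noteq> pair x 0" by (rule pair_separates)
    then have "pair x l \<noteq> 1" by simp
    then show ?thesis unfolding P_def by (rule bump_separating) blast
  qed
  then obtain F C N M where P: "\<And>l. l \<in> L \<Longrightarrow> P l (F l) (C l) (N l) (M l)"
    by metis
  have F: "\<And>l. l \<in> L \<Longrightarrow> continuous_on UNIV (F l)"
    "\<And>l W \<gamma>. l \<in> L \<Longrightarrow> loc_norm pair W (F l) \<gamma> \<le> ereal (C l)"
    "\<And>l. l \<in> L \<Longrightarrow> open (N l)" "\<And>l. l \<in> L \<Longrightarrow> 0 \<in> N l" "\<And>l \<gamma>. l \<in> L \<Longrightarrow> \<gamma> \<in> N l \<Longrightarrow> F l \<gamma> = 1"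
    "\<And>l. l \<in> L \<Longrightarrow> open (M l)" "\<And>l. l \<in> L \<Longrightarrow> l \<in> M l" "\<And>l \<gamma>. l \<in> L \<Longrightarrow> \<gamma> \<in> M l \<Longrightarrow> F l \<gamma> = 0"
    using P unfolding P_def by blast+
  have "L \<subseteq> (\<Union>l\<in>L. M l)" using F(7) by blast
  then obtain I where I: "I \<subseteq> L" "finite I" "L \<subseteq> (\<Union>l\<in>I. M l)"
    using compactE_image[OF assms(1), of L M] F(6) by metis
  show thesis
  proof (rule that)
    show "continuous_on UNIV (\<lambda>\<gamma>. \<Prod>l\<in>I. F l \<gamma>)"
      using I(1) by (intro continuous_on_prod F(1)) auto
    show "loc_norm pair W (\<lambda>\<gamma>. \<Prod>l\<in>I. F l \<gamma>) \<gamma> \<le> ereal (\<Prod>l\<in>I. C l)" for W \<gamma>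
      using I(1) by (intro loc_norm_prod F(2)) auto
    show "open (\<Inter>l\<in>I. N l)" "0 \<in> (\<Inter>l\<in>I. N l)"
      using I(1,2) F(3,4) by (auto intro!: open_INT)
    show "(\<Prod>l\<in>I. F l \<gamma>) = 1" if "\<gamma> \<in> (\<Inter>l\<in>I. N l)" for \<gamma>
      using that I(1) F(5) by (intro prod.neutral) blast
    show "(\<Prod>l\<in>I. F l \<gamma>) = 0" if \<gamma>: "\<gamma> \<in> L" for \<gamma>
    proof -
      obtain l where "l \<in> I" "\<gamma> \<in> M l" using \<gamma> I(3) by blast
      then show ?thesis using I(1,2) F(8)[of l \<gamma>] by (intro prod_zero) auto
    qed
  qed
qed

end

section \<open>Local units and the algebra\<close>

locale local_bse = dual_pairing pair
  for pair :: "'a::{ab_group_add, topological_space} \<Rightarrow> 'g::{ab_group_add, topological_space} \<Rightarrow> complex" +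
  fixes V :: "'g set"
  assumes open_V: "open V" and zero_in_V: "0 \<in> V" and compact_closure_V: "compact (closure V)"
begin

abbreviation nrm :: "('g \<Rightarrow> complex) \<Rightarrow> 'g \<Rightarrow> ereal" where
  "nrm \<equiv> loc_norm pair (closure V)"

lemma zero_in_closure_V: "0 \<in> closure V"
  using zero_in_V closure_subset by blast

lemma cmod_le_nrm: "nrm \<phi> \<gamma> \<le> ereal C \<Longrightarrow> cmod (\<phi> \<gamma>) \<le> C"
  using cmod_le_loc_norm zero_in_closure_V by blast

text \<open>A function that is \<open>1\<close> near \<open>0\<close> and vanishes on \<open>E - V\<close>, where \<open>E = W + W - W\<close> and \<open>W = closure V\<close>,
  may be cut off outside \<open>V\<close>: a translate of \<open>W\<close> that meets \<open>V\<close> lies in \<open>E\<close>,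
  where the cut-off changes nothing.\<close>
lemma compactly_supported_bump:
  obtains b C N where "continuous_on UNIV b" "\<And>\<gamma>. nrm b \<gamma> \<le> ereal C" "open N" "0 \<in> N"
    "\<And>\<gamma>. \<gamma> \<in> N \<Longrightarrow> b \<gamma> = 1" "\<And>\<gamma>. \<gamma> \<notin> closure V \<Longrightarrow> b \<gamma> = 0"
proof -
  let ?W = "closure V"
  define D where "D = {v - w |v w. v \<in> ?W \<and> w \<in> ?W}"
  define E where "E = {d + w |d w. d \<in> D \<and> w \<in> ?W}"
  have "compact E"
    unfolding E_def D_def by (intro compact_sums_dual compact_diffs_dual compact_closure_V)
  then have "compact (E - V)" using open_V by (rule compact_diff)
  then obtain F C N where F: "continuous_on UNIV F" "\<And>W \<gamma>. loc_norm pair W F \<gamma> \<le> ereal C"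
    "open N" "0 \<in> N" "\<And>\<gamma>. \<gamma> \<in> N \<Longrightarrow> F \<gamma> = 1" "\<And>\<gamma>. \<gamma> \<in> E - V \<Longrightarrow> F \<gamma> = 0"
    using zero_in_V by (elim bump_vanishing_on_compact) blast+
  have W_E: "?W \<subseteq> E"
  proof
    fix v assume "v \<in> ?W"
    moreover have "v - v \<in> D" using \<open>v \<in> ?W\<close> unfolding D_def by blast
    ultimately have "(v - v) + v \<in> E" unfolding E_def by blast
    then show "v \<in> E" by simp
  qed
  define b where "b \<gamma> = (if \<gamma> \<in> ?W then F \<gamma> else 0)" for \<gamma>
  \<comment> \<open>On \<open>closure V - V\<close>, which lies in \<open>E - V\<close>, the
    function \<open>F\<close> vanishes, so cutting off outside \<open>V\<close> or outside
    \<open>closure V\<close> gives the same function.\<close>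
  have b_V: "b \<gamma> = (if \<gamma> \<in> V then F \<gamma> else 0)" for \<gamma>
    using F(6) W_E closure_subset[of V] unfolding b_def by auto
  \<comment> \<open>The closed sets \<open>closure V\<close> and \<open>- V\<close> cover the dual,
    and the two branches agree on their overlap.\<close>
  have "continuous_on (?W \<union> - V) (\<lambda>\<gamma>. if \<gamma> \<in> ?W then F \<gamma> else 0)"
    using F(6) W_E open_V
    by (intro continuous_on_If continuous_on_const continuous_on_subset[OF F(1)]) auto
  moreover have "?W \<union> - V = UNIV" using closure_subset[of V] by blast
  ultimately have cont: "continuous_on UNIV b" unfolding b_def[abs_def] by simp
  have C: "0 \<le> C" using loc_norm_bound_nonneg[OF F(2)[of ?W 0]] .
  have "nrm b \<gamma> \<le> ereal C" for \<gamma>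
  proof (cases "\<exists>w\<in>?W. w + \<gamma> \<in> V")
    case True
    then obtain w where w: "w \<in> ?W" "w + \<gamma> \<in> V" by blast
    have "b (v + \<gamma>) = F (v + \<gamma>)" if v: "v \<in> ?W" for v
    proof -
      \<comment> \<open>This difference is \<gamma> itself, so \<gamma> lies in \<open>D\<close> and
        the whole translate of \<open>closure V\<close> lies in \<open>E\<close>.\<close>
      have "(w + \<gamma>) - w \<in> D" using w closure_subset[of V] unfolding D_def by blast
      then have "\<gamma> + v \<in> E" using v unfolding E_def by auto
      then have "v + \<gamma> \<in> E" by (simp add: add.commute)
      then show ?thesis using F(6)[of "v + \<gamma>"] unfolding b_V by auto
    qed
    then have "nrm b \<gamma> = nrm F \<gamma>" by (rule loc_norm_cong)
    then show ?thesis using F(2) by simp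
  next
    case False
    then have "nrm b \<gamma> = nrm (\<lambda>_. 0) \<gamma>" by (intro loc_norm_cong) (auto simp: b_V)
    also have "\<dots> \<le> ereal C" using order_trans[OF loc_norm_zero, of "ereal C"] C by simp
    finally show ?thesis .
  qed
  moreover have "open (N \<inter> V)" "0 \<in> N \<inter> V" using F(3,4) open_V zero_in_V by blast+
  moreover have "b \<gamma> = 1" if "\<gamma> \<in> N \<inter> V" for \<gamma> using that F(5) by (simp add: b_V)
  moreover have "b \<gamma> = 0" if "\<gamma> \<notin> closure V" for \<gamma> using that by (simp add: b_def)
  ultimately show thesis by (rule that[OF cont])
qed

text \<open>Separated subsets of the compact set have bounded size, so one of largest size exists. A
  point that no translate \<open>N + t\<close> contains could be adjoined to it; symmetry of
  \<open>N\<close> settles both orders of subtraction.\<close>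

lemma maximal_separated_subset:
  fixes \<Omega> N :: "'g set"
  assumes "compact \<Omega>" "open N" "0 \<in> N" and sym: "\<And>\<gamma>. \<gamma> \<in> N \<Longrightarrow> - \<gamma> \<in> N"
  obtains T where "finite T" "\<And>s t. s \<in> T \<Longrightarrow> t \<in> T \<Longrightarrow> s \<noteq> t \<Longrightarrow> s - t \<notin> N"
    "\<And>\<omega>. \<omega> \<in> \<Omega> \<Longrightarrow> \<exists>t\<in>T. \<omega> - t \<in> N"
proof -
  define P where "P T \<longleftrightarrow> T \<subseteq> \<Omega> \<and> (\<forall>s\<in>T. \<forall>t\<in>T. s \<noteq> t \<longrightarrow> s - t \<notin> N)" for T
  obtain m where "\<And>T \<gamma>. (\<And>s t. s \<in> T \<Longrightarrow> t \<in> T \<Longrightarrow> s \<noteq> t \<Longrightarrow> s - t \<notin> N) \<Longrightarrow>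
     T \<subseteq> (\<lambda>v. v + \<gamma>) ` \<Omega> \<Longrightarrow> finite T \<and> card T \<le> m"
    using separated_card_bound[OF assms(1-3)] by metis
  from this[of _ 0] have m: "finite T \<and> card T \<le> m" if "P T" for T
    using that unfolding P_def by simp
  have "P {}" by (simp add: P_def)
  then obtain T where T: "P T" "\<And>T'. P T' \<Longrightarrow> card T' \<le> card T"
    using ex_has_greatest_nat[of P "{}" card "Suc m"] m by (auto simp: less_Suc_eq_le)
  have "\<exists>t\<in>T. \<omega> - t \<in> N" if "\<omega> \<in> \<Omega>" for \<omega>
  proof (rule ccontr)
    assume *: "\<not> (\<exists>t\<in>T. \<omega> - t \<in> N)"
    have "t - \<omega> \<notin> N" if "t \<in> T" for t
      using * that sym[of "t - \<omega>"] by auto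
    then have "P (insert \<omega> T)" using * T(1) \<open>\<omega> \<in> \<Omega>\<close> unfolding P_def by auto
    moreover have "\<omega> \<notin> T" using * assms(3) by auto
    ultimately show False using T(2)[of "insert \<omega> T"] m[OF T(1)] by simp
  qed
  then show thesis using T(1) m[OF T(1)] unfolding P_def by (intro that[of T]) auto
qed

text \<open>Every \<open>W + \<gamma>\<close> meets the supports of at most \<open>m\<close> of the translated bumps, whatever the size of
  \<open>\<Omega>\<close>; this keeps the local norms of \<open>1 - \<Prod>(1 - b(\<cdot> - t))\<close> bounded independently of \<open>\<Omega>\<close>.\<close>
lemma bounded_local_units:
  obtains C where "0 \<le> C"
    "\<And>\<Omega>. compact \<Omega> \<Longrightarrow> \<exists>u K. continuous_on UNIV u \<and> (\<forall>\<gamma>. nrm u \<gamma> \<le> ereal C) \<and>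
       (\<forall>\<gamma>\<in>\<Omega>. u \<gamma> = 1) \<and> compact K \<and> (\<forall>\<gamma>. \<gamma> \<notin> K \<longrightarrow> u \<gamma> = 0)"
proof -
  let ?W = "closure V"
  obtain b C N0 where b: "continuous_on UNIV b" "\<And>\<gamma>. nrm b \<gamma> \<le> ereal C" "open N0" "0 \<in> N0"
    "\<And>\<gamma>. \<gamma> \<in> N0 \<Longrightarrow> b \<gamma> = 1" "\<And>\<gamma>. \<gamma> \<notin> ?W \<Longrightarrow> b \<gamma> = 0"
    using compactly_supported_bump by metis
  have C: "0 \<le> C" using loc_norm_bound_nonneg[OF b(2)] .
  define N where "N = N0 \<inter> uminus -` N0"
  have "open (uminus -` N0)"
    by (intro open_vimage b(3) continuous_minus_dual[OF continuous_on_id])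
  then have N: "open N" "0 \<in> N" "\<And>\<gamma>. \<gamma> \<in> N \<Longrightarrow> - \<gamma> \<in> N" "\<And>\<gamma>. \<gamma> \<in> N \<Longrightarrow> b \<gamma> = 1"
    using b(3-5) by (auto simp: N_def)
  \<comment> \<open>A bump translated by \<open>t\<close> can be non-zero on
    \<open>closure V + \<gamma>\<close> only for \<open>t\<close> in \<open>D + \<gamma>\<close>,
    and \<open>m\<close> bounds the number of such separated points.\<close>
  define D where "D = {v - w |v w. v \<in> ?W \<and> w \<in> ?W}"
  have "compact D" unfolding D_def by (intro compact_diffs_dual compact_closure_V)
  from separated_card_bound[OF this N(1,2)]
  obtain m where m: "\<And>T \<gamma>. (\<And>s t. s \<in> T \<Longrightarrow> t \<in> T \<Longrightarrow> s \<noteq> t \<Longrightarrow> s - t \<notin> N) \<Longrightarrow>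
     T \<subseteq> (\<lambda>v. v + \<gamma>) ` D \<Longrightarrow> finite T \<and> card T \<le> m"
    by metis
  show thesis
  proof (rule that)
    show "0 \<le> 1 + (1 + C) ^ m" using C by simp
    fix \<Omega> :: "'g set" assume "compact \<Omega>"
    from maximal_separated_subset[OF this N(1-3)]
    obtain T where T: "finite T" "\<And>s t. s \<in> T \<Longrightarrow> t \<in> T \<Longrightarrow> s \<noteq> t \<Longrightarrow> s - t \<notin> N"
      "\<And>\<omega>. \<omega> \<in> \<Omega> \<Longrightarrow> \<exists>t\<in>T. \<omega> - t \<in> N"
      by metis
    \<comment> \<open>On \<Omega> some factor is 0, so \<open>u\<close> is 1; off the finitely many
      translates of \<open>closure V\<close> all factors are 1, so \<open>u\<close> is 0.\<close>
    define u where "u \<gamma> = 1 - (\<Prod>t\<in>T. 1 - b (\<gamma> - t))" for \<gamma>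
    have "continuous_on UNIV u"
      unfolding u_def
      by (intro continuous_on_diff continuous_on_prod continuous_on_const continuous_on_compose2[OF b(1)]
          continuous_diff_dual continuous_on_id subset_UNIV)
    moreover have "nrm u \<gamma> \<le> ereal (1 + (1 + C) ^ m)" for \<gamma>
    proof -
      define S where "S = {t \<in> T. \<exists>w\<in>?W. b (w + \<gamma> - t) \<noteq> 0}"
      have "S \<subseteq> (\<lambda>v. v + \<gamma>) ` D"
      proof
        fix t assume "t \<in> S"
        then obtain w where w: "w \<in> ?W" "b (w + \<gamma> - t) \<noteq> 0" unfolding S_def by blast
        then have "w - (w + \<gamma> - t) \<in> D" using b(6) unfolding D_def by blast
        then show "t \<in> (\<lambda>v. v + \<gamma>) ` D" by (intro image_eqI[of _ _ "w - (w + \<gamma> - t)"]) simp_all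
      qed
      then have card: "card S \<le> m" using m[of S \<gamma>] T(2) by (auto simp: S_def)
      have "nrm u \<gamma> = nrm (\<lambda>\<gamma>. 1 - (\<Prod>t\<in>S. 1 - b (\<gamma> - t))) \<gamma>"
      proof (rule loc_norm_cong)
        fix w assume "w \<in> ?W"
        then have "(\<Prod>t\<in>T. 1 - b (w + \<gamma> - t)) = (\<Prod>t\<in>S. 1 - b (w + \<gamma> - t))"
          using T(1) by (intro prod.mono_neutral_right) (auto simp: S_def)
        then show "u (w + \<gamma>) = 1 - (\<Prod>t\<in>S. 1 - b (w + \<gamma> - t))" by (simp add: u_def)
      qed
      also have "\<dots> \<le> ereal (1 + (\<Prod>t\<in>S. 1 + C))"
        by (intro loc_norm_diff loc_norm_prod loc_norm_one loc_norm_translate b(2))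
      \<comment> \<open>At most \<open>m\<close> factors remain, and each bound \<open>1 + C\<close>
        is at least 1.\<close>
      also have "\<dots> \<le> ereal (1 + (1 + C) ^ m)"
        using card C by (simp add: power_increasing)
      finally show ?thesis .
    qed
    moreover have "u \<gamma> = 1" if \<gamma>: "\<gamma> \<in> \<Omega>" for \<gamma>
    proof -
      obtain t where "t \<in> T" "\<gamma> - t \<in> N" using T(3)[OF \<gamma>] by blast
      then have "(\<Prod>t\<in>T. 1 - b (\<gamma> - t)) = 0" using T(1) N(4) by (intro prod_zero) auto
      then show ?thesis by (simp add: u_def)
    qed
    moreover have "compact (\<Union>t\<in>T. (\<lambda>v. v + t) ` ?W)"
      by (intro compact_UN T(1) compact_translate_dual compact_closure_V)
    moreover have "u \<gamma> = 0" if \<gamma>: "\<gamma> \<notin> (\<Union>t\<in>T. (\<lambda>v. v + t) ` ?W)" for \<gamma>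
    proof -
      have "b (\<gamma> - t) = 0" if "t \<in> T" for t
      proof (rule b(6), rule notI)
        assume "\<gamma> - t \<in> ?W"
        then have "\<gamma> \<in> (\<lambda>v. v + t) ` ?W" by (intro image_eqI[of _ _ "\<gamma> - t"]) simp_all
        then show False using \<gamma> that by blast
      qed
      then show ?thesis by (simp add: u_def)
    qed
    ultimately show "\<exists>u K. continuous_on UNIV u \<and> (\<forall>\<gamma>. nrm u \<gamma> \<le> ereal (1 + (1 + C) ^ m)) \<and>
       (\<forall>\<gamma>\<in>\<Omega>. u \<gamma> = 1) \<and> compact K \<and> (\<forall>\<gamma>. \<gamma> \<notin> K \<longrightarrow> u \<gamma> = 0)"
      by blast
  qed
qed

section \<open>Compact sets in \<open>KK\<close> and a description of the algebra by real
  bounds\<close>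

lemma compact_subset_KK:
  fixes K :: "'g set"
  assumes "compact K"
  obtains \<Omega> where "\<Omega> \<in> KK" "K \<subseteq> \<Omega>"
proof -
  \<comment> \<open>The point 0 ensures a non-empty interior even when \<open>K\<close> is
    empty.\<close>
  have "compact (insert 0 K)" using assms by simp
  moreover have "insert 0 K \<subseteq> (\<Union>k\<in>insert 0 K. (\<lambda>v. v + k) ` V)"
  proof
    fix k assume "k \<in> insert 0 K"
    then show "k \<in> (\<Union>k\<in>insert 0 K. (\<lambda>v. v + k) ` V)"
      using zero_in_V by (intro UN_I[of k] image_eqI[of _ _ 0]) simp_all
  qed
  ultimately obtain I where I: "I \<subseteq> insert 0 K" "finite I" "insert 0 K \<subseteq> (\<Union>k\<in>I. (\<lambda>v. v + k) ` V)"
    using compactE_image[of "insert 0 K" "insert 0 K" "\<lambda>k. (\<lambda>v. v + k) ` V"] open_translate_dual[OF open_V]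
    by metis
  define U where "U = (\<Union>k\<in>I. (\<lambda>v. v + k) ` V)"
  define \<Omega> where "\<Omega> = (\<Union>k\<in>I. (\<lambda>v. v + k) ` closure V)"
  have "U \<subseteq> \<Omega>" unfolding U_def \<Omega>_def using closure_subset[of V] by blast
  moreover have "open U" unfolding U_def by (intro open_UN ballI open_translate_dual open_V)
  ultimately have int: "U \<subseteq> interior \<Omega>" by (rule interior_maximal)
  have "compact \<Omega>"
    unfolding \<Omega>_def by (intro compact_UN I(2) compact_translate_dual compact_closure_V)
  moreover have "0 \<in> U" "K \<subseteq> U" using I(3) unfolding U_def by simp_all
  then have "interior \<Omega> \<noteq> {}" "K \<subseteq> \<Omega>" using int \<open>U \<subseteq> \<Omega>\<close> by auto
  \<comment> \<open>Translations are continuous, so each translate of \<open>closure V\<close> lies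
    in the closure of the open translate of \<open>V\<close>, which is part of the interior.\<close>
  moreover have "\<Omega> \<subseteq> closure (interior \<Omega>)"
  proof -
    have "(\<lambda>v. v + k) ` closure V \<subseteq> closure (interior \<Omega>)" if k: "k \<in> I" for k
    proof (rule image_closure_subset)
      show "continuous_on (closure V) (\<lambda>v. v + k)"
        by (intro continuous_add_dual continuous_on_id continuous_on_const)
      have "(\<lambda>v. v + k) ` V \<subseteq> U" unfolding U_def using k by blast
      then show "(\<lambda>v. v + k) ` V \<subseteq> closure (interior \<Omega>)"
        using int closure_subset[of "interior \<Omega>"] by blast
    qed simp
    then show ?thesis unfolding \<Omega>_def by blast
  qed
  ultimately show thesis by (intro that[of \<Omega>]) (simp_all add: KK_def)
qed

lemma bse_norm_nonneg: "0 \<le> bse_norm pair (closure V) \<psi>"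
  unfolding bse_norm_def by (rule SUP_upper2[of 0]) (auto intro: loc_norm_nonneg)

text \<open>Replaces the extended-real suprema and the limit along \<open>KK\<close> by real bounds
  off compact sets. Conversely, boundedness of \<psi> comes from its norm bound, and an arbitrary
  compact set is enlarged to a member of \<open>KK\<close>.\<close>

lemma AA_iff:
  "\<psi> \<in> AA pair (closure V) \<longleftrightarrow> continuous_on UNIV \<psi> \<and> (\<exists>C. \<forall>\<gamma>. nrm \<psi> \<gamma> \<le> ereal C) \<and>
     (\<forall>\<epsilon>>0. \<exists>K. compact K \<and> (\<forall>\<gamma>. \<gamma> \<notin> K \<longrightarrow> nrm \<psi> \<gamma> \<le> ereal \<epsilon>))" (is "?L \<longleftrightarrow> ?R")
proof
  assume L: ?L
  have "bse_norm pair (closure V) \<psi> < \<infinity>" using L by (simp add: AA_def C_BSE_def)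
  then obtain C where "bse_norm pair (closure V) \<psi> = ereal C"
    using bse_norm_nonneg[of \<psi>] by (cases "bse_norm pair (closure V) \<psi>") auto
  then have "\<forall>\<gamma>. nrm \<psi> \<gamma> \<le> ereal C"
    unfolding bse_norm_def by (metis SUP_upper UNIV_I)
  moreover have "\<exists>K. compact K \<and> (\<forall>\<gamma>. \<gamma> \<notin> K \<longrightarrow> nrm \<psi> \<gamma> \<le> ereal \<epsilon>)" if \<epsilon>: "\<epsilon> > 0" for \<epsilon>
  proof -
    obtain \<Omega> where \<Omega>: "\<Omega> \<in> KK" "(SUP \<gamma>\<in>-\<Omega>. nrm \<psi> \<gamma>) < ereal \<epsilon>"
      using L \<epsilon> unfolding AA_def by blast
    have "nrm \<psi> \<gamma> \<le> ereal \<epsilon>" if "\<gamma> \<notin> \<Omega>" for \<gamma>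
      using \<Omega>(2) SUP_upper[of \<gamma> "- \<Omega>" "nrm \<psi>"] that by (meson ComplI le_less_trans less_imp_le)
    then show ?thesis using \<Omega>(1) unfolding KK_def by blast
  qed
  ultimately show ?R using L by (auto simp: AA_def C_BSE_def Cb_def)
next
  assume R: ?R
  then obtain C where C: "\<And>\<gamma>. nrm \<psi> \<gamma> \<le> ereal C" by blast
  have "bse_norm pair (closure V) \<psi> \<le> ereal C"
    unfolding bse_norm_def using C by (intro SUP_least)
  then have "bse_norm pair (closure V) \<psi> < \<infinity>" by auto
  moreover have "bounded (range \<psi>)"
    using cmod_le_nrm[OF C] by (auto simp: bounded_iff)
  moreover have "\<exists>\<Omega>0\<in>KK. \<forall>\<Omega>\<in>KK. \<Omega>0 \<subseteq> \<Omega> \<longrightarrow> (SUP \<gamma>\<in>-\<Omega>. nrm \<psi> \<gamma>) < ereal \<epsilon>" if "\<epsilon> > 0" for \<epsilon>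
  proof -
    \<comment> \<open>The limit condition is strict while a supremum inherits only a weak bound,
      hence half of \<epsilon>.\<close>
    obtain K where K: "compact K" "\<And>\<gamma>. \<gamma> \<notin> K \<Longrightarrow> nrm \<psi> \<gamma> \<le> ereal (\<epsilon> / 2)"
      using R \<open>\<epsilon> > 0\<close> half_gt_zero by blast
    obtain \<Omega>0 where \<Omega>0: "\<Omega>0 \<in> KK" "K \<subseteq> \<Omega>0" using compact_subset_KK[OF K(1)] .
    have "(SUP \<gamma>\<in>-\<Omega>. nrm \<psi> \<gamma>) < ereal \<epsilon>" if "\<Omega>0 \<subseteq> \<Omega>" for \<Omega>
    proof -
      have "(SUP \<gamma>\<in>-\<Omega>. nrm \<psi> \<gamma>) \<le> ereal (\<epsilon> / 2)"
        using K(2) \<Omega>0(2) that by (intro SUP_least) blast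
      also have "\<dots> < ereal \<epsilon>" using \<open>\<epsilon> > 0\<close> by simp
      finally show ?thesis .
    qed
    then show ?thesis using \<Omega>0(1) by blast
  qed
  ultimately show ?L using R by (simp add: AA_def C_BSE_def Cb_def)
qed

end

section \<open>The norm of \<open>L\<^sup>p\<close>\<close>

text \<open>Convexity of the \<open>p\<close>-th power, applied to \<open>(s + t) / (a + b)\<close>
  as the combination of \<open>s / a\<close> and \<open>t / b\<close> with weights
  \<open>a / (a + b)\<close> and \<open>b / (a + b)\<close>. Integrated, it gives Minkowski's
  inequality.\<close>

lemma powr_convex_combination:
  fixes a b s t p :: real
  assumes "a > 0" "b > 0" "s \<ge> 0" "t \<ge> 0" "p \<ge> 1"
  shows "(s + t) powr p \<le> (a + b) powr p * (a / (a + b) * (s / a) powr p + b / (a + b) * (t / b) powr p)"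
proof -
  define l where "l = a / (a + b)"
  have l: "0 < l" "l < 1" and l': "1 - l = b / (a + b)" using assms by (simp_all add: l_def field_simps)
  \<comment> \<open>Convexity is applied on the open half-line only. If \<open>s\<close> or
    \<open>t\<close> is 0, a single term is left, and \<open>k powr p \<le> k\<close> for
    \<open>0 < k < 1\<close> handles it.\<close>
  have boundary: "(k * x) powr p \<le> k * x powr p" if "0 < k" "k < 1" "0 \<le> x" for k x :: real
  proof -
    have "k powr p \<le> k powr 1" using that assms(5) by (intro powr_mono') auto
    then show ?thesis using that by (simp add: powr_mult mult_right_mono)
  qed
  have "(l * (s / a) + (1 - l) * (t / b)) powr p \<le> l * (s / a) powr p + (1 - l) * (t / b) powr p"
  proof (cases "s = 0 \<or> t = 0")
    case True
    then show ?thesis using boundary[of l "s / a"] boundary[of "1 - l" "t / b"] l assms by auto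
  next
    case False
    then have "s / a \<in> {0<..}" "t / b \<in> {0<..}" using assms by auto
    from convex_onD[OF powr_convex[OF assms(5)], of "1 - l", OF _ _ this] l
    show ?thesis by simp
  qed
  moreover have "l * (s / a) + (1 - l) * (t / b) = (s + t) / (a + b)"
    unfolding l' using assms by (simp add: l_def add_divide_distrib)
  ultimately have "((s + t) / (a + b)) powr p \<le> l * (s / a) powr p + (1 - l) * (t / b) powr p"
    by simp
  then have "(a + b) powr p * ((s + t) / (a + b)) powr p
      \<le> (a + b) powr p * (l * (s / a) powr p + (1 - l) * (t / b) powr p)"
    by (intro mult_left_mono) auto
  moreover have "(a + b) powr p * ((s + t) / (a + b)) powr p = (s + t) powr p"
    using assms by (simp flip: powr_mult)
  ultimately show ?thesis unfolding l' by (simp add: l_def)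
qed

lemma Lp_norm_nonneg: "0 \<le> Lp_norm p \<mu> f"
  by (simp add: Lp_norm_def)

lemma in_Lp_measurable: "in_Lp p \<mu> f \<Longrightarrow> f \<in> borel_measurable \<mu>"
  by (simp add: in_Lp_def)

lemma nn_integral_powr_eq_Lp_norm:
  assumes "in_Lp p \<mu> f" "p \<ge> 1"
  shows "(\<integral>\<^sup>+ x. ennreal (cmod (f x) powr p) \<partial>\<mu>) = ennreal (Lp_norm p \<mu> f powr p)"
  using assms by (simp add: in_Lp_def Lp_norm_def powr_powr ennreal_enn2real_if less_top)

lemma Lp_norm_leI:
  assumes "f \<in> borel_measurable \<mu>" "0 \<le> A" "p \<ge> 1"
    "(\<integral>\<^sup>+ x. ennreal (cmod (f x) powr p) \<partial>\<mu>) \<le> ennreal (A powr p)"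
  shows "in_Lp p \<mu> f \<and> Lp_norm p \<mu> f \<le> A"
proof -
  have Lp: "in_Lp p \<mu> f"
    using assms(1,4) unfolding in_Lp_def by (auto intro: le_less_trans)
  have "Lp_norm p \<mu> f powr p \<le> A powr p"
    using assms(4) unfolding nn_integral_powr_eq_Lp_norm[OF Lp assms(3)] by simp
  then have "(Lp_norm p \<mu> f powr p) powr (1 / p) \<le> (A powr p) powr (1 / p)"
    by (rule powr_mono2[rotated 2]) (use assms(3) in simp_all)
  moreover have "(Lp_norm p \<mu> f powr p) powr (1 / p) = Lp_norm p \<mu> f" "(A powr p) powr (1 / p) = A"
    using assms(2,3) Lp_norm_nonneg[of p \<mu> f] by (simp_all add: powr_powr)
  ultimately show ?thesis using Lp by simp
qed

lemma Lp_zero: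
  assumes "p \<ge> 1"
  shows "in_Lp p \<mu> (\<lambda>_. 0)" "Lp_norm p \<mu> (\<lambda>_. 0) = 0"
  using assms by (simp_all add: in_Lp_def Lp_norm_def)

lemma Lp_scale:
  assumes f: "in_Lp p \<mu> f" and p: "p \<ge> 1"
  shows "in_Lp p \<mu> (\<lambda>x. a * f x)" "Lp_norm p \<mu> (\<lambda>x. a * f x) = cmod a * Lp_norm p \<mu> f"
proof -
  have [measurable]: "f \<in> borel_measurable \<mu>" using in_Lp_measurable[OF f] .
  have "(\<integral>\<^sup>+ x. ennreal (cmod (a * f x) powr p) \<partial>\<mu>)
      = (\<integral>\<^sup>+ x. ennreal (cmod a powr p) * ennreal (cmod (f x) powr p) \<partial>\<mu>)"
    by (simp add: norm_mult powr_mult ennreal_mult)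
  also have "\<dots> = ennreal (cmod a powr p) * ennreal (Lp_norm p \<mu> f powr p)"
    by (simp add: nn_integral_cmult flip: nn_integral_powr_eq_Lp_norm[OF f p])
  also have "\<dots> = ennreal ((cmod a * Lp_norm p \<mu> f) powr p)"
    by (simp add: powr_mult Lp_norm_nonneg ennreal_mult)
  finally have I: "(\<integral>\<^sup>+ x. ennreal (cmod (a * f x) powr p) \<partial>\<mu>) = ennreal ((cmod a * Lp_norm p \<mu> f) powr p)" .
  then show "in_Lp p \<mu> (\<lambda>x. a * f x)" by (simp add: in_Lp_def)
  show "Lp_norm p \<mu> (\<lambda>x. a * f x) = cmod a * Lp_norm p \<mu> f"
    unfolding Lp_norm_def[of p \<mu> "\<lambda>x. a * f x"] I
    using p Lp_norm_nonneg[of p \<mu> f] by (simp add: powr_powr)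
qed

lemma Lp_dominated:
  assumes f: "in_Lp p \<mu> f" and p: "p \<ge> 1" and g: "g \<in> borel_measurable \<mu>"
    and M: "0 \<le> M" "\<And>x. cmod (g x) \<le> M * cmod (f x)"
  shows "in_Lp p \<mu> g" "Lp_norm p \<mu> g \<le> M * Lp_norm p \<mu> f"
proof -
  have "(\<integral>\<^sup>+ x. ennreal (cmod (g x) powr p) \<partial>\<mu>)
      \<le> (\<integral>\<^sup>+ x. ennreal (cmod (complex_of_real M * f x) powr p) \<partial>\<mu>)"
    using M p by (intro nn_integral_mono ennreal_leI powr_mono2) (auto simp: norm_mult)
  also have "\<dots> = ennreal ((M * Lp_norm p \<mu> f) powr p)"
    unfolding nn_integral_powr_eq_Lp_norm[OF Lp_scale(1)[OF f p] p] Lp_scale(2)[OF f p] using M(1) by simp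
  finally show "in_Lp p \<mu> g" "Lp_norm p \<mu> g \<le> M * Lp_norm p \<mu> f"
    using Lp_norm_leI[OF g _ p] M(1) Lp_norm_nonneg[of p \<mu> f] by (metis mult_nonneg_nonneg)+
qed

text \<open>Minkowski's inequality. Taking \<open>a\<close> and \<open>b\<close> strictly above the
  two norms keeps both positive, so norms equal to 0 fall under the same argument; then
  \<open>a\<close> and \<open>b\<close> decrease to the norms.\<close>

lemma Lp_add:
  assumes f: "in_Lp p \<mu> f" and g: "in_Lp p \<mu> g" and p: "p \<ge> 1"
  shows "in_Lp p \<mu> (\<lambda>x. f x + g x)" "Lp_norm p \<mu> (\<lambda>x. f x + g x) \<le> Lp_norm p \<mu> f + Lp_norm p \<mu> g"
proof -
  have [measurable]: "f \<in> borel_measurable \<mu>" "g \<in> borel_measurable \<mu>"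
    using in_Lp_measurable f g by blast+
  have *: "in_Lp p \<mu> (\<lambda>x. f x + g x) \<and> Lp_norm p \<mu> (\<lambda>x. f x + g x) \<le> a + b"
    if a: "Lp_norm p \<mu> f < a" and b: "Lp_norm p \<mu> g < b" for a b
  proof (rule Lp_norm_leI[OF _ _ p])
    have ab: "a > 0" "b > 0" using a b Lp_norm_nonneg[of p \<mu>] by (meson le_less_trans)+
    then show "0 \<le> a + b" by simp
    \<comment> \<open>The weights are chosen so that
      \<open>A * a powr p + B * b powr p = (a + b) powr p\<close>.\<close>
    define A where "A = (a + b) powr p * (a / (a + b)) / a powr p"
    define B where "B = (a + b) powr p * (b / (a + b)) / b powr p"
    have AB: "0 \<le> A" "0 \<le> B" using ab by (simp_all add: A_def B_def)
    have "cmod (f x + g x) powr p \<le> A * cmod (f x) powr p + B * cmod (g x) powr p" for x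
    proof -
      have "cmod (f x + g x) powr p \<le> (cmod (f x) + cmod (g x)) powr p"
        using p by (intro powr_mono2 norm_triangle_ineq) auto
      also have "\<dots> \<le> (a + b) powr p * (a / (a + b) * (cmod (f x) / a) powr p + b / (a + b) * (cmod (g x) / b) powr p)"
        using ab p by (intro powr_convex_combination) auto
      also have "\<dots> = A * cmod (f x) powr p + B * cmod (g x) powr p"
        using ab by (simp add: A_def B_def powr_divide distrib_left)
      finally show ?thesis .
    qed
    then have "(\<integral>\<^sup>+ x. ennreal (cmod (f x + g x) powr p) \<partial>\<mu>)
        \<le> (\<integral>\<^sup>+ x. ennreal A * ennreal (cmod (f x) powr p) + ennreal B * ennreal (cmod (g x) powr p) \<partial>\<mu>)"
      using AB by (intro nn_integral_mono) (simp flip: ennreal_mult ennreal_plus)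
    also have "\<dots> = ennreal A * ennreal (Lp_norm p \<mu> f powr p) + ennreal B * ennreal (Lp_norm p \<mu> g powr p)"
      by (simp add: nn_integral_add nn_integral_cmult flip: nn_integral_powr_eq_Lp_norm[OF f p] nn_integral_powr_eq_Lp_norm[OF g p])
    also have "\<dots> \<le> ennreal A * ennreal (a powr p) + ennreal B * ennreal (b powr p)"
      using a b p Lp_norm_nonneg[of p \<mu>] by (intro add_mono mult_left_mono ennreal_leI powr_mono2) auto
    also have "\<dots> = ennreal (A * a powr p + B * b powr p)"
      using AB by (simp flip: ennreal_mult ennreal_plus)
    also have "A * a powr p + B * b powr p = (a + b) powr p * ((a + b) / (a + b))"
      using ab by (simp add: A_def B_def add_divide_distrib distrib_left del: divide_self_if divide_self)
    also have "\<dots> = (a + b) powr p" using ab by simp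
    finally show "(\<integral>\<^sup>+ x. ennreal (cmod (f x + g x) powr p) \<partial>\<mu>) \<le> ennreal ((a + b) powr p)" .
  qed measurable
  show "in_Lp p \<mu> (\<lambda>x. f x + g x)"
    using *[of "Lp_norm p \<mu> f + 1" "Lp_norm p \<mu> g + 1"] by simp
  show "Lp_norm p \<mu> (\<lambda>x. f x + g x) \<le> Lp_norm p \<mu> f + Lp_norm p \<mu> g"
  proof (rule field_le_epsilon)
    fix e :: real assume "e > 0"
    then show "Lp_norm p \<mu> (\<lambda>x. f x + g x) \<le> Lp_norm p \<mu> f + Lp_norm p \<mu> g + e"
      using *[of "Lp_norm p \<mu> f + e / 2" "Lp_norm p \<mu> g + e / 2"] by simp
  qed
qed

text \<open>Fatou's lemma applied to the \<open>p\<close>-th powers.\<close>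

lemma Lp_limit:
  fixes f :: "nat \<Rightarrow> 'b \<Rightarrow> complex"
  assumes f: "\<And>n. in_Lp p \<mu> (f n)" and lim: "\<And>x. (\<lambda>n. f n x) \<longlonglongrightarrow> g x" and p: "p \<ge> 1"
    and A: "\<forall>\<^sub>F n in sequentially. Lp_norm p \<mu> (f n) \<le> A"
  shows "in_Lp p \<mu> g" "Lp_norm p \<mu> g \<le> A"
proof -
  have [measurable]: "f n \<in> borel_measurable \<mu>" for n using in_Lp_measurable[OF f] .
  have g: "g \<in> borel_measurable \<mu>"
    by (rule borel_measurable_LIMSEQ_metric[OF _ lim]) measurable
  obtain n0 where n0: "\<And>n. n \<ge> n0 \<Longrightarrow> Lp_norm p \<mu> (f n) \<le> A"
    using A by (auto simp: eventually_sequentially)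
  have A0: "0 \<le> A" using n0[OF order_refl] Lp_norm_nonneg[of p \<mu> "f n0"] by linarith
  have "liminf (\<lambda>n. ennreal (cmod (f n x) powr p)) = ennreal (cmod (g x) powr p)" for x
    using p by (intro lim_imp_Liminf tendsto_ennrealI tendsto_powr' tendsto_norm lim tendsto_const) auto
  then have "(\<integral>\<^sup>+ x. ennreal (cmod (g x) powr p) \<partial>\<mu>)
      = (\<integral>\<^sup>+ x. liminf (\<lambda>n. ennreal (cmod (f n x) powr p)) \<partial>\<mu>)"
    by simp
  also have "\<dots> \<le> liminf (\<lambda>n. \<integral>\<^sup>+ x. ennreal (cmod (f n x) powr p) \<partial>\<mu>)"
    by (intro nn_integral_liminf) measurable
  also have "\<dots> \<le> ennreal (A powr p)"
  proof (rule Liminf_le)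
    have "(\<integral>\<^sup>+ x. ennreal (cmod (f n x) powr p) \<partial>\<mu>) \<le> ennreal (A powr p)" if "n \<ge> n0" for n
      unfolding nn_integral_powr_eq_Lp_norm[OF f p]
      using n0[OF that] p Lp_norm_nonneg[of p \<mu> "f n"] by (intro ennreal_leI powr_mono2) auto
    then show "\<forall>\<^sub>F n in sequentially. (\<integral>\<^sup>+ x. ennreal (cmod (f n x) powr p) \<partial>\<mu>) \<le> ennreal (A powr p)"
      by (auto simp: eventually_sequentially)
  qed simp
  finally show "in_Lp p \<mu> g" "Lp_norm p \<mu> g \<le> A"
    using Lp_norm_leI[OF g A0 p] by blast+
qed

text \<open>By dominated convergence the integral of the \<open>p\<close>-th power over the set
  where the modulus of \<open>f\<close> is at most \<open>1 / (n + 1)\<close> tends to 0. Small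
  values thus contribute little to the norm, and functions in the algebra have small values off a
  compact set.\<close>

lemma Lp_norm_small_values:
  fixes f :: "'b \<Rightarrow> complex"
  assumes f: "in_Lp p \<mu> f" and p: "p \<ge> 1" and e: "e > 0"
  obtains d where "d > 0"
    "\<And>g. g \<in> borel_measurable \<mu> \<Longrightarrow> (\<And>x. cmod (g x) \<le> cmod (f x)) \<Longrightarrow>
       (\<And>x. d < cmod (f x) \<Longrightarrow> g x = 0) \<Longrightarrow> Lp_norm p \<mu> g \<le> e"
proof -
  have [measurable]: "f \<in> borel_measurable \<mu>" using in_Lp_measurable[OF f] .
  define h where "h n x = (if cmod (f x) \<le> 1 / Suc n then cmod (f x) powr p else 0)" for n x
  have h_meas [measurable]: "h n \<in> borel_measurable \<mu>" for n
    unfolding h_def by measurable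
  have "(\<lambda>n. ennreal (h n x)) \<longlonglongrightarrow> ennreal 0" for x
  proof (cases "f x = 0")
    case True
    then show ?thesis by (simp add: h_def)
  next
    case False
    then obtain N where N: "1 / Suc N < cmod (f x)"
      using nat_approx_posE[of "cmod (f x)"] by auto
    have "h n x = 0" if "n \<ge> N" for n
    proof -
      have "1 / Suc n \<le> 1 / Suc N" using that by (simp add: frac_le)
      then show ?thesis using N by (simp add: h_def)
    qed
    then have "\<forall>\<^sub>F n in sequentially. ennreal (h n x) = ennreal 0"
      unfolding eventually_sequentially by (intro exI[of _ N]) simp
    then show ?thesis by (rule tendsto_eventually)
  qed
  then have "(\<lambda>n. \<integral>\<^sup>+ x. ennreal (h n x) \<partial>\<mu>) \<longlonglongrightarrow> (\<integral>\<^sup>+ x. ennreal 0 \<partial>\<mu>)"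
    using f by (intro nn_integral_dominated_convergence[where w = "\<lambda>x. ennreal (cmod (f x) powr p)"])
      (auto simp: h_def in_Lp_def)
  then have "\<forall>\<^sub>F n in sequentially. (\<integral>\<^sup>+ x. ennreal (h n x) \<partial>\<mu>) < ennreal (e powr p)"
    using e by (intro order_tendstoD(2)[where y = 0]) auto
  then obtain n where n: "(\<integral>\<^sup>+ x. ennreal (h n x) \<partial>\<mu>) < ennreal (e powr p)"
    by (auto simp: eventually_sequentially)
  show thesis
  proof (rule that[of "1 / Suc n"])
    fix g assume g: "g \<in> borel_measurable \<mu>" "\<And>x. cmod (g x) \<le> cmod (f x)"
      "\<And>x. 1 / Suc n < cmod (f x) \<Longrightarrow> g x = 0"
    have "(\<integral>\<^sup>+ x. ennreal (cmod (g x) powr p) \<partial>\<mu>) \<le> (\<integral>\<^sup>+ x. ennreal (h n x) \<partial>\<mu>)"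
      using g(2,3) p by (intro nn_integral_mono ennreal_leI) (auto simp: h_def intro!: powr_mono2)
    then have "(\<integral>\<^sup>+ x. ennreal (cmod (g x) powr p) \<partial>\<mu>) \<le> ennreal (e powr p)"
      using n by simp
    then show "Lp_norm p \<mu> g \<le> e" using Lp_norm_leI[OF g(1) _ p, of e] e by simp
  qed simp
qed

section \<open>The Banach algebra and its Segal algebras\<close>

context local_bse
begin

section \<open>Linear structure, products and completeness of the algebra\<close>

abbreviation AV :: "('g \<Rightarrow> complex) set" where
  "AV \<equiv> AA pair (closure V)"

abbreviation nA :: "('g \<Rightarrow> complex) \<Rightarrow> real" where
  "nA \<equiv> AA_norm pair (closure V)"

lemma AV_continuous: "\<psi> \<in> AV \<Longrightarrow> continuous_on UNIV \<psi>"
  by (simp add: AA_iff)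

lemma AV_tail:
  assumes "\<psi> \<in> AV" "\<epsilon> > 0"
  obtains K where "compact K" "\<And>\<gamma>. \<gamma> \<notin> K \<Longrightarrow> nrm \<psi> \<gamma> \<le> ereal \<epsilon>"
  using assms unfolding AA_iff by blast

lemma nA_nonneg: "0 \<le> nA \<psi>"
  unfolding AA_norm_def by (simp add: bse_norm_nonneg real_of_ereal_pos)

lemma nA_leI:
  assumes "\<And>\<gamma>. nrm \<psi> \<gamma> \<le> ereal C"
  shows "nA \<psi> \<le> C"
proof -
  have "bse_norm pair (closure V) \<psi> \<le> ereal C"
    unfolding bse_norm_def using assms by (intro SUP_least)
  then show ?thesis
    using bse_norm_nonneg[of \<psi>] unfolding AA_norm_def
    by (cases "bse_norm pair (closure V) \<psi>") auto
qed

text \<open>For members of the algebra the supremum is finite, so \<open>real_of_ereal\<close>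
  returns it and not the default 0.\<close>

lemma nrm_le_nA:
  assumes "\<psi> \<in> AV"
  shows "nrm \<psi> \<gamma> \<le> ereal (nA \<psi>)"
proof -
  have "bse_norm pair (closure V) \<psi> < \<infinity>" using assms by (simp add: AA_def C_BSE_def)
  then have "bse_norm pair (closure V) \<psi> = ereal (nA \<psi>)"
    using bse_norm_nonneg[of \<psi>] unfolding AA_norm_def
    by (cases "bse_norm pair (closure V) \<psi>") auto
  then show ?thesis unfolding bse_norm_def by (metis SUP_upper UNIV_I)
qed

lemma cmod_le_nA: "\<psi> \<in> AV \<Longrightarrow> cmod (\<psi> \<gamma>) \<le> nA \<psi>"
  using cmod_le_nrm nrm_le_nA by blast

lemma AV_I:
  assumes "continuous_on UNIV \<psi>" "\<And>\<gamma>. nrm \<psi> \<gamma> \<le> ereal C"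
    "\<And>\<epsilon>. \<epsilon> > 0 \<Longrightarrow> \<exists>K. compact K \<and> (\<forall>\<gamma>. \<gamma> \<notin> K \<longrightarrow> nrm \<psi> \<gamma> \<le> ereal \<epsilon>)"
  shows "\<psi> \<in> AV"
  using assms unfolding AA_iff by blast

lemma AV_zero: "(\<lambda>_. 0) \<in> AV"
proof (rule AV_I)
  fix \<epsilon> :: real assume "\<epsilon> > 0"
  have "nrm (\<lambda>_. 0) \<gamma> \<le> ereal \<epsilon>" for \<gamma>
    using order_trans[OF loc_norm_zero, of "ereal \<epsilon>"] \<open>\<epsilon> > 0\<close> by simp
  then show "\<exists>K. compact K \<and> (\<forall>\<gamma>. \<gamma> \<notin> K \<longrightarrow> nrm (\<lambda>_. 0) \<gamma> \<le> ereal \<epsilon>)"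
    by (intro exI[of _ "{}"]) simp
qed (auto intro: loc_norm_zero)

lemma AV_add:
  assumes \<phi>: "\<phi> \<in> AV" and \<psi>: "\<psi> \<in> AV"
  shows "(\<lambda>\<gamma>. \<phi> \<gamma> + \<psi> \<gamma>) \<in> AV" "nA (\<lambda>\<gamma>. \<phi> \<gamma> + \<psi> \<gamma>) \<le> nA \<phi> + nA \<psi>"
proof -
  have bound: "nrm (\<lambda>\<gamma>. \<phi> \<gamma> + \<psi> \<gamma>) \<gamma> \<le> ereal (nA \<phi> + nA \<psi>)" for \<gamma>
    by (intro loc_norm_add nrm_le_nA \<phi> \<psi>)
  then show "nA (\<lambda>\<gamma>. \<phi> \<gamma> + \<psi> \<gamma>) \<le> nA \<phi> + nA \<psi>" by (rule nA_leI)
  show "(\<lambda>\<gamma>. \<phi> \<gamma> + \<psi> \<gamma>) \<in> AV"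
  proof (rule AV_I[OF _ bound])
    show "continuous_on UNIV (\<lambda>\<gamma>. \<phi> \<gamma> + \<psi> \<gamma>)"
      by (intro continuous_on_add AV_continuous \<phi> \<psi>)
    fix \<epsilon> :: real assume "\<epsilon> > 0"
    then have "\<epsilon> / 2 > 0" by simp
    obtain K where K: "compact K" "\<And>\<gamma>. \<gamma> \<notin> K \<Longrightarrow> nrm \<phi> \<gamma> \<le> ereal (\<epsilon> / 2)"
      using AV_tail[OF \<phi> \<open>\<epsilon> / 2 > 0\<close>] by blast
    obtain L where L: "compact L" "\<And>\<gamma>. \<gamma> \<notin> L \<Longrightarrow> nrm \<psi> \<gamma> \<le> ereal (\<epsilon> / 2)"
      using AV_tail[OF \<psi> \<open>\<epsilon> / 2 > 0\<close>] by blast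
    have "nrm (\<lambda>\<gamma>. \<phi> \<gamma> + \<psi> \<gamma>) \<gamma> \<le> ereal (\<epsilon> / 2 + \<epsilon> / 2)" if "\<gamma> \<notin> K \<union> L" for \<gamma>
      using that by (intro loc_norm_add K(2) L(2)) auto
    then show "\<exists>K. compact K \<and> (\<forall>\<gamma>. \<gamma> \<notin> K \<longrightarrow> nrm (\<lambda>\<gamma>. \<phi> \<gamma> + \<psi> \<gamma>) \<gamma> \<le> ereal \<epsilon>)"
      using compact_Un[OF K(1) L(1)] by (intro exI[of _ "K \<union> L"]) simp
  qed
qed

text \<open>The second factor has bounded local norms but may lack decay, so constants qualify as
  well as members of the algebra; the tail condition comes from the first factor.\<close>

lemma AV_mult:
  assumes \<phi>: "\<phi> \<in> AV" and \<psi>: "continuous_on UNIV \<psi>" "\<And>\<gamma>. nrm \<psi> \<gamma> \<le> ereal C"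
  shows "(\<lambda>\<gamma>. \<phi> \<gamma> * \<psi> \<gamma>) \<in> AV" "nA (\<lambda>\<gamma>. \<phi> \<gamma> * \<psi> \<gamma>) \<le> nA \<phi> * C"
proof -
  have C: "0 \<le> C" using loc_norm_bound_nonneg[OF \<psi>(2)] .
  have bound: "nrm (\<lambda>\<gamma>. \<phi> \<gamma> * \<psi> \<gamma>) \<gamma> \<le> ereal (nA \<phi> * C)" for \<gamma>
    by (intro loc_norm_mult nrm_le_nA \<phi> \<psi>)
  then show "nA (\<lambda>\<gamma>. \<phi> \<gamma> * \<psi> \<gamma>) \<le> nA \<phi> * C" by (rule nA_leI)
  show "(\<lambda>\<gamma>. \<phi> \<gamma> * \<psi> \<gamma>) \<in> AV"
  proof (rule AV_I[OF _ bound])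
    show "continuous_on UNIV (\<lambda>\<gamma>. \<phi> \<gamma> * \<psi> \<gamma>)"
      by (intro continuous_on_mult AV_continuous \<phi> \<psi>)
    fix \<epsilon> :: real assume \<epsilon>: "\<epsilon> > 0"
    then have "\<epsilon> / (C + 1) > 0" using C by simp
    then obtain K where K: "compact K" "\<And>\<gamma>. \<gamma> \<notin> K \<Longrightarrow> nrm \<phi> \<gamma> \<le> ereal (\<epsilon> / (C + 1))"
      using AV_tail[OF \<phi>] by blast
    have "\<epsilon> / (C + 1) * C \<le> \<epsilon>" using \<epsilon> C by (simp add: field_simps)
    then have "nrm (\<lambda>\<gamma>. \<phi> \<gamma> * \<psi> \<gamma>) \<gamma> \<le> ereal \<epsilon>" if "\<gamma> \<notin> K" for \<gamma>
      using order_trans[OF loc_norm_mult[OF K(2)[OF that] \<psi>(2)], of "ereal \<epsilon>"] by simp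
    then show "\<exists>K. compact K \<and> (\<forall>\<gamma>. \<gamma> \<notin> K \<longrightarrow> nrm (\<lambda>\<gamma>. \<phi> \<gamma> * \<psi> \<gamma>) \<gamma> \<le> ereal \<epsilon>)"
      using K(1) by blast
  qed
qed

lemma AV_scale:
  assumes "\<phi> \<in> AV"
  shows "(\<lambda>\<gamma>. a * \<phi> \<gamma>) \<in> AV" "nA (\<lambda>\<gamma>. a * \<phi> \<gamma>) = cmod a * nA \<phi>"
proof -
  have *: "(\<lambda>\<gamma>. b * \<psi> \<gamma>) \<in> AV \<and> nA (\<lambda>\<gamma>. b * \<psi> \<gamma>) \<le> cmod b * nA \<psi>" if "\<psi> \<in> AV" for b \<psi>
    using AV_mult[OF that continuous_on_const loc_norm_const, of b] by (simp add: mult.commute)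
  show in_AV: "(\<lambda>\<gamma>. a * \<phi> \<gamma>) \<in> AV" using *[OF assms] by blast
  show "nA (\<lambda>\<gamma>. a * \<phi> \<gamma>) = cmod a * nA \<phi>"
  proof (cases "a = 0")
    case True
    then show ?thesis using *[OF assms, of 0] nA_nonneg[of "\<lambda>_. 0"] by simp
  next
    case False
    \<comment> \<open>Scaling back by \<open>inverse a\<close> turns the upper bound for multiples
      into the lower one.\<close>
    have "nA \<phi> \<le> cmod (inverse a) * nA (\<lambda>\<gamma>. a * \<phi> \<gamma>)"
      using *[OF in_AV, of "inverse a"] False by (simp flip: mult.assoc)
    then have "cmod a * nA \<phi> \<le> nA (\<lambda>\<gamma>. a * \<phi> \<gamma>)"
      using False by (simp add: norm_divide field_simps)
    then show ?thesis using *[OF assms, of a] by simp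
  qed
qed

lemma AV_diff:
  assumes "\<phi> \<in> AV" "\<psi> \<in> AV"
  shows "(\<lambda>\<gamma>. \<phi> \<gamma> - \<psi> \<gamma>) \<in> AV"
  using AV_add(1)[OF assms(1) AV_scale(1)[OF assms(2), of "-1"]] by simp

text \<open>Local norms dominate values, so the sequence converges uniformly, and norm estimates
  pass to pointwise limits. The pointwise limit is part of the conclusion because it also identifies
  the limit in \<open>L^p\<close>.\<close>

lemma AV_complete:
  assumes f: "\<And>n. f n \<in> AV"
    and cauchy: "\<And>\<epsilon>. \<epsilon> > 0 \<Longrightarrow> \<exists>N. \<forall>m\<ge>N. \<forall>n\<ge>N. nA (\<lambda>\<gamma>. f m \<gamma> - f n \<gamma>) < \<epsilon>"
  obtains \<phi> where "\<phi> \<in> AV" "\<And>\<gamma>. (\<lambda>n. f n \<gamma>) \<longlonglongrightarrow> \<phi> \<gamma>"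
    "\<And>\<epsilon>. \<epsilon> > 0 \<Longrightarrow> \<exists>N. \<forall>n\<ge>N. nA (\<lambda>\<gamma>. f n \<gamma> - \<phi> \<gamma>) \<le> \<epsilon>"
proof -
  have cmod_le: "cmod (f m \<gamma> - f n \<gamma>) \<le> nA (\<lambda>\<gamma>. f m \<gamma> - f n \<gamma>)" for m n \<gamma>
    by (rule cmod_le_nA[OF AV_diff[OF f f]])
  have "Cauchy (\<lambda>n. f n \<gamma>)" for \<gamma>
  proof (rule CauchyI)
    fix e :: real assume "e > 0"
    then obtain N where "\<forall>m\<ge>N. \<forall>n\<ge>N. nA (\<lambda>\<gamma>. f m \<gamma> - f n \<gamma>) < e" using cauchy by blast
    then show "\<exists>N. \<forall>m\<ge>N. \<forall>n\<ge>N. norm (f m \<gamma> - f n \<gamma>) < e"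
      using cmod_le by (meson le_less_trans)
  qed
  then obtain \<phi> where lim: "\<And>\<gamma>. (\<lambda>n. f n \<gamma>) \<longlonglongrightarrow> \<phi> \<gamma>"
    unfolding Cauchy_convergent_iff convergent_def by metis
  have close: "\<exists>N. \<forall>n\<ge>N. \<forall>\<gamma>. nrm (\<lambda>\<gamma>. f n \<gamma> - \<phi> \<gamma>) \<gamma> \<le> ereal \<epsilon>" if \<epsilon>: "\<epsilon> > 0" for \<epsilon>
  proof -
    obtain N where N: "\<forall>m\<ge>N. \<forall>n\<ge>N. nA (\<lambda>\<gamma>. f m \<gamma> - f n \<gamma>) < \<epsilon>" using cauchy[OF \<epsilon>] by blast
    have "nrm (\<lambda>\<gamma>. f n \<gamma> - \<phi> \<gamma>) \<gamma> \<le> ereal \<epsilon>" if "n \<ge> N" for n \<gamma>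
    proof (rule loc_norm_limit)
      show "(\<lambda>m. f n \<delta> - f m \<delta>) \<longlonglongrightarrow> f n \<delta> - \<phi> \<delta>" for \<delta>
        by (intro tendsto_diff tendsto_const lim)
      have "nrm (\<lambda>\<gamma>. f n \<gamma> - f m \<gamma>) \<gamma> \<le> ereal \<epsilon>" if "m \<ge> N" for m
        using order_trans[OF nrm_le_nA[OF AV_diff[OF f f]], of n m "ereal \<epsilon>"] N that \<open>n \<ge> N\<close>
        by (simp add: less_imp_le)
      then show "\<forall>\<^sub>F m in sequentially. nrm (\<lambda>\<gamma>. f n \<gamma> - f m \<gamma>) \<gamma> \<le> ereal \<epsilon>"
        unfolding eventually_sequentially by blast
    qed
    then show ?thesis by blast
  qed
  have \<phi>_le: "nrm \<phi> \<gamma> \<le> ereal (A + B)"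
    if "nrm (f n) \<gamma> \<le> ereal A" "nrm (\<lambda>\<gamma>. f n \<gamma> - \<phi> \<gamma>) \<gamma> \<le> ereal B" for n \<gamma> A B
    using loc_norm_diff[OF that] by simp
  obtain N1 where N1: "\<forall>n\<ge>N1. \<forall>\<gamma>. nrm (\<lambda>\<gamma>. f n \<gamma> - \<phi> \<gamma>) \<gamma> \<le> ereal 1"
    using close[of 1] by auto
  have "\<phi> \<in> AV"
  proof (rule AV_I)
    have "uniform_limit UNIV f \<phi> sequentially"
    proof (rule uniform_limitI)
      fix e :: real assume "e > 0"
      then obtain N where "\<forall>n\<ge>N. \<forall>\<gamma>. nrm (\<lambda>\<gamma>. f n \<gamma> - \<phi> \<gamma>) \<gamma> \<le> ereal (e / 2)"
        using close half_gt_zero by blast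
      then have half: "cmod (f n \<gamma> - \<phi> \<gamma>) \<le> e / 2" if "n \<ge> N" for n \<gamma>
        using cmod_le_nrm that by blast
      have "dist (f n \<gamma>) (\<phi> \<gamma>) < e" if "n \<ge> N" for n \<gamma>
        using half[OF that, of \<gamma>] \<open>e > 0\<close> unfolding dist_norm by linarith
      then show "\<forall>\<^sub>F n in sequentially. \<forall>\<gamma>\<in>UNIV. dist (f n \<gamma>) (\<phi> \<gamma>) < e"
        unfolding eventually_sequentially by blast
    qed
    then show "continuous_on UNIV \<phi>"
      by (rule uniform_limit_theorem[rotated]) (simp_all add: AV_continuous f)
    show "nrm \<phi> \<gamma> \<le> ereal (nA (f N1) + 1)" for \<gamma>
      using N1 by (intro \<phi>_le[of N1] nrm_le_nA f) blast
  next
    fix \<epsilon> :: real assume "\<epsilon> > 0"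
    then have \<epsilon>2: "\<epsilon> / 2 > 0" by simp
    obtain N where N: "\<forall>n\<ge>N. \<forall>\<gamma>. nrm (\<lambda>\<gamma>. f n \<gamma> - \<phi> \<gamma>) \<gamma> \<le> ereal (\<epsilon> / 2)"
      using close[OF \<epsilon>2] by blast
    obtain K where K: "compact K" "\<And>\<gamma>. \<gamma> \<notin> K \<Longrightarrow> nrm (f N) \<gamma> \<le> ereal (\<epsilon> / 2)"
      using AV_tail[OF f \<epsilon>2] by blast
    have "nrm \<phi> \<gamma> \<le> ereal (\<epsilon> / 2 + \<epsilon> / 2)" if "\<gamma> \<notin> K" for \<gamma>
      using N by (intro \<phi>_le[of N] K(2) that) blast
    then show "\<exists>K. compact K \<and> (\<forall>\<gamma>. \<gamma> \<notin> K \<longrightarrow> nrm \<phi> \<gamma> \<le> ereal \<epsilon>)"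
      using K(1) by auto
  qed
  moreover have "\<exists>N. \<forall>n\<ge>N. nA (\<lambda>\<gamma>. f n \<gamma> - \<phi> \<gamma>) \<le> \<epsilon>" if "\<epsilon> > 0" for \<epsilon>
    using close[OF that] nA_leI by meson
  ultimately show thesis using lim by (intro that)
qed

text \<open>For \<gamma> outside the compact set \<open>K - closure V\<close>, the translate
  \<open>closure V + \<gamma>\<close> misses \<open>K\<close>, and the local norm there is
  0.\<close>

lemma compactly_supported_in_AV:
  assumes u: "continuous_on UNIV u" "\<And>\<gamma>. nrm u \<gamma> \<le> ereal C" and K: "compact K" "\<And>\<gamma>. \<gamma> \<notin> K \<Longrightarrow> u \<gamma> = 0"
  shows "u \<in> AV"
proof (rule AV_I[OF u])
  fix \<epsilon> :: real assume "\<epsilon> > 0"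
  define D where "D = {k - w |k w. k \<in> K \<and> w \<in> closure V}"
  have "nrm u \<gamma> \<le> ereal \<epsilon>" if "\<gamma> \<notin> D" for \<gamma>
  proof -
    have "u (w + \<gamma>) = 0" if "w \<in> closure V" for w
    proof (rule K(2), rule notI)
      assume "w + \<gamma> \<in> K"
      then have "(w + \<gamma>) - w \<in> D" using that unfolding D_def by blast
      then show False using \<open>\<gamma> \<notin> D\<close> by simp
    qed
    then have "nrm u \<gamma> = nrm (\<lambda>_. 0) \<gamma>" by (rule loc_norm_cong)
    also have "\<dots> \<le> ereal \<epsilon>"
      using order_trans[OF loc_norm_zero, of "ereal \<epsilon>"] \<open>\<epsilon> > 0\<close> by simp
    finally show ?thesis .
  qed
  moreover have "compact D" unfolding D_def by (intro compact_diffs_dual K compact_closure_V)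
  ultimately show "\<exists>K. compact K \<and> (\<forall>\<gamma>. \<gamma> \<notin> K \<longrightarrow> nrm u \<gamma> \<le> ereal \<epsilon>)" by blast
qed

lemma compactly_supported_approximate_units:
  obtains C where "0 \<le> C"
    "\<And>\<psi> (L :: 'g set) \<epsilon>. \<psi> \<in> AV \<Longrightarrow> compact L \<Longrightarrow> \<epsilon> > 0 \<Longrightarrow> \<exists>u\<in>AV. \<exists>K. compact K \<and> (\<forall>\<gamma>. \<gamma> \<notin> K \<longrightarrow> u \<gamma> = 0) \<and>
       (\<forall>\<gamma>. cmod (u \<gamma>) \<le> C) \<and> (\<forall>\<gamma>\<in>L. u \<gamma> = 1) \<and> nA (\<lambda>\<gamma>. \<psi> \<gamma> - u \<gamma> * \<psi> \<gamma>) \<le> \<epsilon>"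
proof -
  obtain C where C: "0 \<le> C"
    "\<And>\<Omega>. compact \<Omega> \<Longrightarrow> \<exists>u K. continuous_on UNIV u \<and> (\<forall>\<gamma>. nrm u \<gamma> \<le> ereal C) \<and>
       (\<forall>\<gamma>\<in>\<Omega>. u \<gamma> = 1) \<and> compact K \<and> (\<forall>\<gamma>. \<gamma> \<notin> K \<longrightarrow> u \<gamma> = 0)"
    using bounded_local_units by blast
  show thesis
  proof (rule that[OF C(1)])
    fix \<psi> and L :: "'g set" and \<epsilon> :: real assume \<psi>: "\<psi> \<in> AV" and L: "compact L" and \<epsilon>: "\<epsilon> > 0"
    have "\<epsilon> / (1 + C) > 0" using \<epsilon> C(1) by simp
    then obtain M where M: "compact M" "\<And>\<gamma>. \<gamma> \<notin> M \<Longrightarrow> nrm \<psi> \<gamma> \<le> ereal (\<epsilon> / (1 + C))"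
      using AV_tail[OF \<psi>] by blast
    \<comment> \<open>For \<gamma> in \<open>M\<close> the unit is 1 on all of
      \<open>closure V + \<gamma>\<close>, so the local norm of the error is 0. Off \<open>M\<close>
      the bound \<open>1 + C\<close> for \<open>1 - u\<close> meets the small norm of
      \<psi>.\<close>
    define \<Omega> where "\<Omega> = {w + k |w k. w \<in> closure V \<and> k \<in> M}"
    have "compact (\<Omega> \<union> L)"
      unfolding \<Omega>_def by (intro compact_Un compact_sums_dual M(1) compact_closure_V L)
    then obtain u K where u: "continuous_on UNIV u" "\<And>\<gamma>. nrm u \<gamma> \<le> ereal C" "\<And>\<gamma>. \<gamma> \<in> \<Omega> \<union> L \<Longrightarrow> u \<gamma> = 1"
      "compact K" "\<And>\<gamma>. \<gamma> \<notin> K \<Longrightarrow> u \<gamma> = 0"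
      using C(2) by metis
    have "nrm (\<lambda>\<gamma>. \<psi> \<gamma> - u \<gamma> * \<psi> \<gamma>) \<gamma> \<le> ereal \<epsilon>" for \<gamma>
    proof (cases "\<gamma> \<in> M")
      case True
      then have "nrm (\<lambda>\<gamma>. \<psi> \<gamma> - u \<gamma> * \<psi> \<gamma>) \<gamma> = nrm (\<lambda>_. 0) \<gamma>"
        using u(3) unfolding \<Omega>_def by (intro loc_norm_cong) auto
      also have "\<dots> \<le> ereal \<epsilon>" using order_trans[OF loc_norm_zero, of "ereal \<epsilon>"] \<epsilon> by simp
      finally show ?thesis .
    next
      case False
      have "nrm (\<lambda>\<gamma>. (1 - u \<gamma>) * \<psi> \<gamma>) \<gamma> \<le> ereal ((1 + C) * (\<epsilon> / (1 + C)))"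
        by (intro loc_norm_mult loc_norm_diff loc_norm_one u M False)
      then show ?thesis using C(1) by (simp add: left_diff_distrib)
    qed
    then have "nA (\<lambda>\<gamma>. \<psi> \<gamma> - u \<gamma> * \<psi> \<gamma>) \<le> \<epsilon>" by (rule nA_leI)
    moreover have "u \<in> AV" by (rule compactly_supported_in_AV[OF u(1,2,4,5)])
    moreover have "cmod (u \<gamma>) \<le> C" for \<gamma> using cmod_le_nrm[OF u(2)] .
    ultimately show "\<exists>u\<in>AV. \<exists>K. compact K \<and> (\<forall>\<gamma>. \<gamma> \<notin> K \<longrightarrow> u \<gamma> = 0) \<and>
       (\<forall>\<gamma>. cmod (u \<gamma>) \<le> C) \<and> (\<forall>\<gamma>\<in>L. u \<gamma> = 1) \<and> nA (\<lambda>\<gamma>. \<psi> \<gamma> - u \<gamma> * \<psi> \<gamma>) \<le> \<epsilon>"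
      using u(3-5) by blast
  qed
qed

section \<open>Measurability and integrability with respect to a Radon measure\<close>

lemma radon_measurable:
  fixes \<psi> :: "'g \<Rightarrow> complex"
  assumes "radon_measure \<mu>" "continuous_on UNIV \<psi>"
  shows "\<psi> \<in> borel_measurable \<mu>"
proof -
  have "sets \<mu> = sets borel" using assms(1) by (simp add: radon_measure_def)
  then show ?thesis
    using borel_measurable_continuous_onI[OF assms(2)] by (simp cong: measurable_cong_sets)
qed

lemma compactly_supported_in_Lp:
  fixes u :: "'g \<Rightarrow> complex"
  assumes \<mu>: "radon_measure \<mu>" and u: "continuous_on UNIV u" "\<And>\<gamma>. cmod (u \<gamma>) \<le> M"
    and K: "compact K" "\<And>\<gamma>. \<gamma> \<notin> K \<Longrightarrow> u \<gamma> = 0" and p: "p \<ge> 1"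
  shows "in_Lp p \<mu> u"
proof -
  have "K \<in> sets borel" by (intro borel_closed compact_imp_closed_dual K)
  then have [measurable]: "K \<in> sets \<mu>" using \<mu> by (simp add: radon_measure_def)
  have "(\<integral>\<^sup>+ \<gamma>. ennreal (cmod (u \<gamma>) powr p) \<partial>\<mu>) \<le> (\<integral>\<^sup>+ \<gamma>. ennreal (M powr p) * indicator K \<gamma> \<partial>\<mu>)"
  proof (rule nn_integral_mono)
    fix \<gamma>
    show "ennreal (cmod (u \<gamma>) powr p) \<le> ennreal (M powr p) * indicator K \<gamma>"
      using u(2)[of \<gamma>] K(2)[of \<gamma>] p by (cases "\<gamma> \<in> K") (auto intro!: ennreal_leI powr_mono2)
  qed
  also have "\<dots> = ennreal (M powr p) * emeasure \<mu> K" by (rule nn_integral_cmult_indicator) measurable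
  also have "\<dots> < \<infinity>" using \<mu> K(1) by (simp add: radon_measure_def ennreal_mult_less_top)
  finally show ?thesis using radon_measurable[OF \<mu> u(1)] by (simp add: in_Lp_def)
qed

end

section \<open>Verification of the Segal algebra axioms\<close>

theorem theorem6p2:
  fixes pair :: "'a::{ab_group_add, t2_space} \<Rightarrow> 'g::{ab_group_add, topological_space} \<Rightarrow> complex"
    and V :: "'g set" and \<mu> :: "'g measure" and p :: real
  assumes "LCA TYPE('a)"
    and "\<not> (\<forall>S::'a set. open S)"
    and "is_dual_pairing pair"
    and "open V" and "0 \<in> V" and "compact (closure V)"
    and "radon_measure \<mu>" and "emeasure \<mu> (space \<mu>) = \<infinity>"
    and "1 \<le> p"
  shows "segal_algebra (AA pair (closure V)) (AA_norm pair (closure V))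
           {\<psi> \<in> AA pair (closure V). in_Lp p \<mu> \<psi>}
           (\<lambda>\<psi>. AA_norm pair (closure V) \<psi> + Lp_norm p \<mu> \<psi>)"
proof -
  interpret local_bse pair V
    by unfold_locales (use assms in auto)
  note p = \<open>1 \<le> p\<close>
  let ?S = "{\<psi> \<in> AV. in_Lp p \<mu> \<psi>}"
  let ?nS = "\<lambda>\<psi>. nA \<psi> + Lp_norm p \<mu> \<psi>"
  have measurable: "\<psi> \<in> borel_measurable \<mu>" if "\<psi> \<in> AV" for \<psi>
    using radon_measurable[OF assms(7) AV_continuous[OF that]] .
  have mult: "(\<lambda>\<gamma>. \<phi> \<gamma> * \<psi> \<gamma>) \<in> ?S \<and> ?nS (\<lambda>\<gamma>. \<phi> \<gamma> * \<psi> \<gamma>) \<le> ?nS \<phi> * nA \<psi>"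
    if \<phi>: "\<phi> \<in> ?S" and \<psi>: "\<psi> \<in> AV" for \<phi> \<psi>
  proof -
    have A: "(\<lambda>\<gamma>. \<phi> \<gamma> * \<psi> \<gamma>) \<in> AV" "nA (\<lambda>\<gamma>. \<phi> \<gamma> * \<psi> \<gamma>) \<le> nA \<phi> * nA \<psi>"
      using AV_mult[of \<phi> \<psi> "nA \<psi>"] \<phi> AV_continuous[OF \<psi>] nrm_le_nA[OF \<psi>] by auto
    have "cmod (\<phi> \<gamma> * \<psi> \<gamma>) \<le> nA \<psi> * cmod (\<phi> \<gamma>)" for \<gamma>
      using cmod_le_nA[OF \<psi>, of \<gamma>] by (simp add: norm_mult mult.commute mult_left_mono)
    then have "in_Lp p \<mu> (\<lambda>\<gamma>. \<phi> \<gamma> * \<psi> \<gamma>)"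
      "Lp_norm p \<mu> (\<lambda>\<gamma>. \<phi> \<gamma> * \<psi> \<gamma>) \<le> nA \<psi> * Lp_norm p \<mu> \<phi>"
      using Lp_dominated[of p \<mu> \<phi> "\<lambda>\<gamma>. \<phi> \<gamma> * \<psi> \<gamma>" "nA \<psi>"] \<phi> p measurable[OF A(1)] nA_nonneg[of \<psi>] by auto
    then show ?thesis using A by (simp add: algebra_simps)
  qed
  have add: "(\<lambda>\<gamma>. \<phi> \<gamma> + \<psi> \<gamma>) \<in> ?S" "?nS (\<lambda>\<gamma>. \<phi> \<gamma> + \<psi> \<gamma>) \<le> ?nS \<phi> + ?nS \<psi>"
    if "\<phi> \<in> ?S" "\<psi> \<in> ?S" for \<phi> \<psi>
    using that AV_add[of \<phi> \<psi>] Lp_add[of p \<mu> \<phi> \<psi>] p by auto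
  have scale: "(\<lambda>\<gamma>. a * \<phi> \<gamma>) \<in> ?S" "?nS (\<lambda>\<gamma>. a * \<phi> \<gamma>) = cmod a * ?nS \<phi>" if "\<phi> \<in> ?S" for a \<phi>
    using that AV_scale[of \<phi> a] Lp_scale[of p \<mu> \<phi> a] p by (auto simp: distrib_left)
  have diff: "(\<lambda>\<gamma>. \<phi> \<gamma> - \<psi> \<gamma>) \<in> ?S" if "\<phi> \<in> ?S" "\<psi> \<in> ?S" for \<phi> \<psi>
    using add(1)[OF that(1) scale(1)[OF that(2), of "-1"]] by simp
  have zero: "(\<lambda>_. 0) \<in> ?S" "?nS (\<lambda>_. 0) = 0"
    using AV_zero AV_scale(2)[OF AV_zero, of 0] Lp_zero[OF p, of \<mu>] by auto
  have norm_zero: "?nS \<phi> = 0 \<longleftrightarrow> \<phi> = (\<lambda>_. 0)" if "\<phi> \<in> ?S" for \<phi>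
  proof
    assume "?nS \<phi> = 0"
    then have "nA \<phi> = 0" using nA_nonneg[of \<phi>] Lp_norm_nonneg[of p \<mu> \<phi>] by linarith
    then show "\<phi> = (\<lambda>_. 0)" using cmod_le_nA[of \<phi>] that by (intro ext) auto
  qed (use zero(2) in simp)
  obtain C where C: "0 \<le> C"
    "\<And>\<psi> (L :: 'g set) \<epsilon>. \<psi> \<in> AV \<Longrightarrow> compact L \<Longrightarrow> \<epsilon> > 0 \<Longrightarrow> \<exists>u\<in>AV. \<exists>K. compact K \<and> (\<forall>\<gamma>. \<gamma> \<notin> K \<longrightarrow> u \<gamma> = 0) \<and>
       (\<forall>\<gamma>. cmod (u \<gamma>) \<le> C) \<and> (\<forall>\<gamma>\<in>L. u \<gamma> = 1) \<and> nA (\<lambda>\<gamma>. \<psi> \<gamma> - u \<gamma> * \<psi> \<gamma>) \<le> \<epsilon>"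
    using compactly_supported_approximate_units by blast
  have units: "\<exists>u\<in>?S. (\<forall>\<gamma>. cmod (u \<gamma>) \<le> C) \<and> (\<forall>\<gamma>\<in>L. u \<gamma> = 1) \<and> nA (\<lambda>\<gamma>. \<psi> \<gamma> - u \<gamma> * \<psi> \<gamma>) \<le> \<epsilon>"
    if \<psi>: "\<psi> \<in> AV" "compact L" "\<epsilon> > 0" for \<psi> L \<epsilon>
  proof -
    obtain u K where u: "u \<in> AV" "compact K" "\<And>\<gamma>. \<gamma> \<notin> K \<Longrightarrow> u \<gamma> = 0" "\<And>\<gamma>. cmod (u \<gamma>) \<le> C"
      "\<forall>\<gamma>\<in>L. u \<gamma> = 1" "nA (\<lambda>\<gamma>. \<psi> \<gamma> - u \<gamma> * \<psi> \<gamma>) \<le> \<epsilon>"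
      using C(2)[OF \<psi>] by blast
    have "in_Lp p \<mu> u"
      using compactly_supported_in_Lp[OF assms(7) AV_continuous[OF u(1)] u(4,2,3) p] .
    then show ?thesis using u by blast
  qed
  have dense: "\<exists>\<phi>\<in>?S. nA (\<lambda>\<gamma>. \<psi> \<gamma> - \<phi> \<gamma>) < \<epsilon>" if \<psi>: "\<psi> \<in> AV" and \<epsilon>: "\<epsilon> > 0" for \<psi> \<epsilon>
  proof -
    \<comment> \<open>Density concerns \<open>nA\<close> alone, so the prescribed set is empty; the
      product with \<open>u\<close> lies in the ideal because \<open>u\<close> does.\<close>
    obtain u where u: "u \<in> ?S" "nA (\<lambda>\<gamma>. \<psi> \<gamma> - u \<gamma> * \<psi> \<gamma>) \<le> \<epsilon> / 2"
      using units[OF \<psi> compact_empty, of "\<epsilon> / 2"] \<epsilon> by auto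
    then show ?thesis using mult[OF u(1) \<psi>] \<epsilon> by (intro bexI[of _ "\<lambda>\<gamma>. u \<gamma> * \<psi> \<gamma>"]) auto
  qed
  have approx: "\<exists>u\<in>?S. ?nS (\<lambda>\<gamma>. \<phi> \<gamma> - u \<gamma> * \<phi> \<gamma>) < \<epsilon>" if \<phi>: "\<phi> \<in> ?S" and \<epsilon>: "\<epsilon> > 0" for \<phi> \<epsilon>
  proof -
    have \<phi>_AV: "\<phi> \<in> AV" and \<phi>_Lp: "in_Lp p \<mu> \<phi>" using \<phi> by auto
    have "\<epsilon> / 3 / (1 + C) > 0" using \<epsilon> C(1) by simp
    from Lp_norm_small_values[OF \<phi>_Lp p this] obtain d where d: "d > 0"
      "\<And>g. g \<in> borel_measurable \<mu> \<Longrightarrow> (\<And>\<gamma>. cmod (g \<gamma>) \<le> cmod (\<phi> \<gamma>)) \<Longrightarrow>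
         (\<And>\<gamma>. d < cmod (\<phi> \<gamma>) \<Longrightarrow> g \<gamma> = 0) \<Longrightarrow> Lp_norm p \<mu> g \<le> \<epsilon> / 3 / (1 + C)"
      by metis
    \<comment> \<open>Off \<open>L\<close> the values of \<phi> are at most \<open>d\<close>. As
      \<open>u\<close> is 1 on \<open>L\<close>, the error vanishes wherever the modulus of \<phi>
      exceeds \<open>d\<close>.\<close>
    obtain L where L: "compact L" "\<And>\<gamma>. \<gamma> \<notin> L \<Longrightarrow> nrm \<phi> \<gamma> \<le> ereal d"
      using AV_tail[OF \<phi>_AV d(1)] by blast
    obtain u where u: "u \<in> ?S" "\<And>\<gamma>. cmod (u \<gamma>) \<le> C" "\<And>\<gamma>. \<gamma> \<in> L \<Longrightarrow> u \<gamma> = 1"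
      "nA (\<lambda>\<gamma>. \<phi> \<gamma> - u \<gamma> * \<phi> \<gamma>) \<le> \<epsilon> / 3"
      using units[OF \<phi>_AV L(1), of "\<epsilon> / 3"] \<epsilon> by auto
    \<comment> \<open>The modulus of \<open>1 - u\<close> is at most \<open>1 + C\<close>; dividing
      by this constant makes the error dominated by \<phi>.\<close>
    define g where "g \<gamma> = complex_of_real (1 / (1 + C)) * (\<phi> \<gamma> - u \<gamma> * \<phi> \<gamma>)" for \<gamma>
    have in_S: "(\<lambda>\<gamma>. \<phi> \<gamma> - u \<gamma> * \<phi> \<gamma>) \<in> ?S"
      using mult[OF u(1) \<phi>_AV] diff[OF \<phi>] by blast
    have "Lp_norm p \<mu> g \<le> \<epsilon> / 3 / (1 + C)"
    proof (rule d(2))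
      show "g \<in> borel_measurable \<mu>"
        using measurable[of g] scale(1)[OF in_S] unfolding g_def[abs_def] by blast
      show "cmod (g \<gamma>) \<le> cmod (\<phi> \<gamma>)" for \<gamma>
      proof -
        have "cmod (1 - u \<gamma>) \<le> 1 + C"
          using norm_triangle_ineq4[of 1 "u \<gamma>"] u(2)[of \<gamma>] by simp
        then have "cmod (1 - u \<gamma>) * cmod (\<phi> \<gamma>) \<le> (1 + C) * cmod (\<phi> \<gamma>)"
          by (intro mult_right_mono) auto
        moreover have "cmod (g \<gamma>) = cmod (1 - u \<gamma>) * cmod (\<phi> \<gamma>) / (1 + C)"
          using C(1) unfolding g_def norm_mult norm_of_real
          by (simp add: left_diff_distrib flip: norm_mult)
        ultimately show ?thesis using C(1) by (simp add: divide_le_eq mult.commute)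
      qed
      show "g \<gamma> = 0" if "d < cmod (\<phi> \<gamma>)" for \<gamma>
        using that cmod_le_nrm[OF L(2), of \<gamma>] u(3)[of \<gamma>] by (force simp: g_def)
    qed
    moreover have "Lp_norm p \<mu> g = 1 / (1 + C) * Lp_norm p \<mu> (\<lambda>\<gamma>. \<phi> \<gamma> - u \<gamma> * \<phi> \<gamma>)"
      using Lp_scale(2)[of p \<mu> "\<lambda>\<gamma>. \<phi> \<gamma> - u \<gamma> * \<phi> \<gamma>" "complex_of_real (1 / (1 + C))"] in_S p C(1)
      unfolding g_def[abs_def] norm_of_real by simp
    ultimately have "Lp_norm p \<mu> (\<lambda>\<gamma>. \<phi> \<gamma> - u \<gamma> * \<phi> \<gamma>) / (1 + C) \<le> \<epsilon> / 3 / (1 + C)"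
      by simp
    then have "Lp_norm p \<mu> (\<lambda>\<gamma>. \<phi> \<gamma> - u \<gamma> * \<phi> \<gamma>) \<le> \<epsilon> / 3"
      using C(1) by (subst (asm) divide_le_cancel) auto
    then show ?thesis using u(1,4) \<epsilon> by (intro bexI[of _ u]) auto
  qed
  have complete: "\<exists>\<phi>\<in>?S. (\<lambda>n. ?nS (\<lambda>\<gamma>. f n \<gamma> - \<phi> \<gamma>)) \<longlonglongrightarrow> 0"
    if f: "\<forall>n. f n \<in> ?S" and cauchy: "\<forall>\<epsilon>>0. \<exists>N. \<forall>m\<ge>N. \<forall>n\<ge>N. ?nS (\<lambda>\<gamma>. f m \<gamma> - f n \<gamma>) < \<epsilon>" for f
  proof -
    have f_AV: "f n \<in> AV" for n using f by simp
    have "\<exists>N. \<forall>m\<ge>N. \<forall>n\<ge>N. nA (\<lambda>\<gamma>. f m \<gamma> - f n \<gamma>) < \<epsilon>" if "\<epsilon> > 0" for \<epsilon>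
      using cauchy that Lp_norm_nonneg[of p \<mu>] by (meson le_add_same_cancel1 le_less_trans)
    from AV_complete[OF f_AV this] obtain \<phi> where \<phi>: "\<phi> \<in> AV" "\<And>\<gamma>. (\<lambda>n. f n \<gamma>) \<longlonglongrightarrow> \<phi> \<gamma>"
      "\<And>\<epsilon>. \<epsilon> > 0 \<Longrightarrow> \<exists>N. \<forall>n\<ge>N. nA (\<lambda>\<gamma>. f n \<gamma> - \<phi> \<gamma>) \<le> \<epsilon>"
      by metis
    \<comment> \<open>For fixed \<open>n\<close>, letting \<open>m\<close> tend to infinity in
      \<open>f n - f m\<close> carries the Cauchy bound over to \<open>f n - \<phi>\<close> by
      Fatou's lemma.\<close>
    have Lp: "\<exists>N. \<forall>n\<ge>N. in_Lp p \<mu> (\<lambda>\<gamma>. f n \<gamma> - \<phi> \<gamma>) \<and> Lp_norm p \<mu> (\<lambda>\<gamma>. f n \<gamma> - \<phi> \<gamma>) \<le> \<epsilon>"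
      if \<epsilon>: "\<epsilon> > 0" for \<epsilon>
    proof -
      obtain N where N: "\<forall>m\<ge>N. \<forall>n\<ge>N. ?nS (\<lambda>\<gamma>. f m \<gamma> - f n \<gamma>) < \<epsilon>"
        using cauchy \<epsilon> by blast
      have "in_Lp p \<mu> (\<lambda>\<gamma>. f n \<gamma> - \<phi> \<gamma>) \<and> Lp_norm p \<mu> (\<lambda>\<gamma>. f n \<gamma> - \<phi> \<gamma>) \<le> \<epsilon>" if n: "n \<ge> N" for n
      proof -
        have "in_Lp p \<mu> (\<lambda>\<gamma>. f n \<gamma> - f m \<gamma>)" for m using diff[of "f n" "f m"] f by blast
        moreover have "(\<lambda>m. f n \<gamma> - f m \<gamma>) \<longlonglongrightarrow> f n \<gamma> - \<phi> \<gamma>" for \<gamma>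
          by (intro tendsto_diff tendsto_const \<phi>(2))
        moreover have "Lp_norm p \<mu> (\<lambda>\<gamma>. f n \<gamma> - f m \<gamma>) \<le> \<epsilon>" if "m \<ge> N" for m
          using N n that nA_nonneg[of "\<lambda>\<gamma>. f n \<gamma> - f m \<gamma>"] by fastforce
        then have "\<forall>\<^sub>F m in sequentially. Lp_norm p \<mu> (\<lambda>\<gamma>. f n \<gamma> - f m \<gamma>) \<le> \<epsilon>"
          unfolding eventually_sequentially by blast
        ultimately show ?thesis
          using Lp_limit[of p \<mu> "\<lambda>m \<gamma>. f n \<gamma> - f m \<gamma>" "\<lambda>\<gamma>. f n \<gamma> - \<phi> \<gamma>" \<epsilon>] p by blast
      qed
      then show ?thesis by blast
    qed
    \<comment> \<open>Membership of \<phi> follows from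
      \<open>\<phi> = f N - (f N - \<phi>)\<close>, a difference of two members.\<close>
    obtain N where "in_Lp p \<mu> (\<lambda>\<gamma>. f N \<gamma> - \<phi> \<gamma>)" using Lp[of 1] by auto
    then have "(\<lambda>\<gamma>. f N \<gamma> - \<phi> \<gamma>) \<in> ?S" using AV_diff[OF f_AV \<phi>(1)] by blast
    then have "(\<lambda>\<gamma>. f N \<gamma> - (f N \<gamma> - \<phi> \<gamma>)) \<in> ?S" using diff f by blast
    then have "\<phi> \<in> ?S" by simp
    moreover have "(\<lambda>n. ?nS (\<lambda>\<gamma>. f n \<gamma> - \<phi> \<gamma>)) \<longlonglongrightarrow> 0 + 0"
    proof (rule tendsto_add)
      have null: "g \<longlonglongrightarrow> 0"
        if g: "\<And>n. 0 \<le> g n" "\<And>\<epsilon>. \<epsilon> > 0 \<Longrightarrow> \<exists>N. \<forall>n\<ge>N. g n \<le> \<epsilon>" for g :: "nat \<Rightarrow> real"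
      proof (rule LIMSEQ_I)
        fix e :: real assume "e > 0"
        then obtain N where "\<forall>n\<ge>N. g n \<le> e / 2" using g(2)[of "e / 2"] by auto
        then have "norm (g n - 0) < e" if "n \<ge> N" for n
          using that g(1)[of n] \<open>e > 0\<close> le_less_trans[of "g n" "e / 2" e] by auto
        then show "\<exists>N. \<forall>n\<ge>N. norm (g n - 0) < e" by blast
      qed
      show "(\<lambda>n. nA (\<lambda>\<gamma>. f n \<gamma> - \<phi> \<gamma>)) \<longlonglongrightarrow> 0"
        by (rule null) (use nA_nonneg \<phi>(3) in auto)
      show "(\<lambda>n. Lp_norm p \<mu> (\<lambda>\<gamma>. f n \<gamma> - \<phi> \<gamma>)) \<longlonglongrightarrow> 0"
        using Lp by (intro null Lp_norm_nonneg) meson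
    qed
    ultimately show ?thesis by auto
  qed
  have le: "nA \<phi> \<le> ?nS \<phi>" for \<phi> using Lp_norm_nonneg[of p \<mu> \<phi>] by simp
  show ?thesis
    unfolding segal_algebra_def
    by (intro conjI ballI allI impI)
      (assumption | rule Collect_restrict mult[THEN conjunct1] mult[THEN conjunct2] dense zero(1) add scale
        norm_zero complete le approx)+
qed

end
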